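(* Let $0\le q\le t$ be integers, let $Q^q_t$ and $R^q_t$ be the projectors defined in the context, and let $u\in H^q(a,b)$. We have $$\|R^q_t u - Q^q_t u\| \leq \|u - Q^q_t u\|.$$ Furthermore, for $\ell=1,\ldots,q-1$, we have $$\|\partial^\ell(R^q_t u - Q^q_t u)\| \leq \left(\frac{1}{b-a}\right)^{\ell}\left(\prod_{i=q-\ell}^{q-1} d_i\right)\|R^q_t u - Q^q_t u\|,\qquad d_i:=\sqrt{\frac{i(i+1)(i+2)(i+3)}{2}}.$$ Finally, for any $\ell\geq q$, we have $$\|\partial^\ell(R^q_t u - Q^q_t u)\|=0.$$
   Context: Let $a<b$ be real. $\|\cdot\|$ and $(\cdot,\cdot)$ denote the norm and inner product of the real space $L^2(a,b)$. $\partial$ is the (weak) derivative, $H^q(a,b)=\{u\in L^2(a,b):\partial^\alpha u\in L^2(a,b),\ \alpha=1,\ldots,q\}$, $H^0(a,b)=L^2(a,b)$; for $u\in H^1(a,b)$ point values are those of the continuous representative. $\mathcal{P}_k$ is the space of polynomials of degree at most $k$ (restricted to $[a,b]$), and $\mathcal{P}_{-1}=\{0\}$. Define $(Kf)(x)=\int_a^x f(y)\,dy$ and its $L^2$-adjoint $(K^*f)(x)=\int_x^b f(y)\,dy$. Let $\mathcal{Z}_0\supseteq\mathcal{P}_0$ be any finite dimensional subspace of $L^2(a,b)$ and for integers $t\ge 1$ let $\mathcal{Z}_t:=\mathcal{P}_0+K(\mathcal{Z}_{t-1})$, where it is assumed that $\mathcal{P}_0+K(\mathcal{Z}_{t-1})=\mathcal{P}_0+K^*(\mathcal{Z}_{t-1})$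 (sums need not be direct). Let $Z_t$ be the $L^2(a,b)$-orthogonal projector onto $\mathcal{Z}_t$. The projectors $Q_t^q:H^q(a,b)\to\mathcal{Z}_t$, $q=0,\ldots,t$, are defined recursively by $Q_t^0:=Z_t$ and, for $q\ge1$, $Q_t^q u:=u(a)+KQ_{t-1}^{q-1}\partial u$. The Ritz projector $R_t^q:H^q(a,b)\to\mathcal{Z}_t$, $q=0,\ldots,t$, is defined by: $R_t^qu\in\mathcal{Z}_t$ satisfies $(\partial^qR_t^qu,\partial^qv)=(\partial^qu,\partial^qv)$ for all $v\in\mathcal{Z}_t$, and $(R_t^qu,g)=(u,g)$ for all $g\in\mathcal{P}_{q-1}$. *)

theory Defs
  imports "HOL-Analysis.Analysis" "HOL-Computational_Algebra.Polynomial"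
begin

text \<open>
  The spaces below are sets of functions of type \<open>real \<Rightarrow> real\<close>, of which only the behaviour
  almost everywhere on \<open>(a,b)\<close> matters.  A subspace of the quotient space \<open>L\<^sup>2(a,b)\<close> is
  represented by the union of its equivalence classes, so it is closed under a.e. equality.
  Operators defined by \<open>SOME\<close> pick a representative of a class.
\<close>

abbreviation leb :: "real \<Rightarrow> real \<Rightarrow> real measure" where
  "leb a b \<equiv> lebesgue_on {a<..<b}"

definition ae_eq :: "real \<Rightarrow> real \<Rightarrow> (real \<Rightarrow> real) \<Rightarrow> (real \<Rightarrow> real) \<Rightarrow> bool" where
  "ae_eq a b f g \<longleftrightarrow> (AE x in leb a b. f x = g x)"

definition L2 :: "real \<Rightarrow> real \<Rightarrow> (real \<Rightarrow> real) set" where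
  "L2 a b = {f. f \<in> borel_measurable (leb a b) \<and> integrable (leb a b) (\<lambda>x. (f x)\<^sup>2)}"

definition ip :: "real \<Rightarrow> real \<Rightarrow> (real \<Rightarrow> real) \<Rightarrow> (real \<Rightarrow> real) \<Rightarrow> real" where
  "ip a b f g = (LINT x|leb a b. f x * g x)"

definition nrm :: "real \<Rightarrow> real \<Rightarrow> (real \<Rightarrow> real) \<Rightarrow> real" where
  "nrm a b f = sqrt (ip a b f f)"

definition L2_subspace :: "real \<Rightarrow> real \<Rightarrow> (real \<Rightarrow> real) set \<Rightarrow> bool" where
  "L2_subspace a b V \<longleftrightarrow>
     V \<subseteq> L2 a b \<and> (\<lambda>x. 0) \<in> V \<and>
     (\<forall>f\<in>V. \<forall>g\<in>V. (\<lambda>x. f x + g x) \<in> V) \<and>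
     (\<forall>c. \<forall>f\<in>V. (\<lambda>x. c * f x) \<in> V) \<and>
     (\<forall>f\<in>V. \<forall>g\<in>L2 a b. ae_eq a b f g \<longrightarrow> g \<in> V)"

definition L2_finite_dim :: "real \<Rightarrow> real \<Rightarrow> (real \<Rightarrow> real) set \<Rightarrow> bool" where
  "L2_finite_dim a b V \<longleftrightarrow>
     (\<exists>B. finite B \<and> B \<subseteq> L2 a b \<and>
        (\<forall>f\<in>V. \<exists>c. ae_eq a b f (\<lambda>x. \<Sum>g\<in>B. c g * g x)))"

definition test_fun :: "real \<Rightarrow> real \<Rightarrow> (real \<Rightarrow> real) \<Rightarrow> bool" where
  "test_fun a b \<phi> \<longleftrightarrow>
     (\<forall>n x. (deriv ^^ n) \<phi> differentiable (at x)) \<and>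
     (\<exists>c d. a < c \<and> d < b \<and> (\<forall>x. x \<notin> {c..d} \<longrightarrow> \<phi> x = 0))"

definition loc_integrable :: "real \<Rightarrow> real \<Rightarrow> (real \<Rightarrow> real) \<Rightarrow> bool" where
  "loc_integrable a b f \<longleftrightarrow> (\<forall>c d. a < c \<and> d < b \<longrightarrow> integrable (lebesgue_on {c..d}) f)"

definition has_weak_deriv ::
    "real \<Rightarrow> real \<Rightarrow> nat \<Rightarrow> (real \<Rightarrow> real) \<Rightarrow> (real \<Rightarrow> real) \<Rightarrow> bool" where
  "has_weak_deriv a b n f g \<longleftrightarrow>
     loc_integrable a b f \<and> loc_integrable a b g \<and>
     (\<forall>\<phi>. test_fun a b \<phi> \<longrightarrow>
        (LINT x|leb a b. f x * (deriv ^^ n) \<phi> x) = (- 1) ^ n * (LINT x|leb a b. g x * \<phi> x))"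

definition weak_deriv :: "real \<Rightarrow> real \<Rightarrow> nat \<Rightarrow> (real \<Rightarrow> real) \<Rightarrow> real \<Rightarrow> real" where
  "weak_deriv a b n f = (SOME g. has_weak_deriv a b n f g)"

definition sobolev :: "real \<Rightarrow> real \<Rightarrow> nat \<Rightarrow> (real \<Rightarrow> real) set" where
  "sobolev a b q = {u \<in> L2 a b. \<forall>n\<in>{1..q}. \<exists>g\<in>L2 a b. has_weak_deriv a b n u g}"

text \<open>The value at \<open>x\<close> of the representative of \<open>u\<close> that is continuous on \<open>[a,b]\<close>.\<close>

definition point_value :: "real \<Rightarrow> real \<Rightarrow> (real \<Rightarrow> real) \<Rightarrow> real \<Rightarrow> real" where
  "point_value a b u x = (THE y. \<exists>w. continuous_on {a..b} w \<and> ae_eq a b u w \<and> w x = y)"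

text \<open>The degree bound is an integer so that the bound \<open>-1\<close> gives the zero space.\<close>

definition polys :: "real \<Rightarrow> real \<Rightarrow> int \<Rightarrow> (real \<Rightarrow> real) set" where
  "polys a b k = {f \<in> L2 a b. \<exists>p :: real poly. (p = 0 \<or> int (degree p) \<le> k) \<and> ae_eq a b f (poly p)}"

definition K :: "real \<Rightarrow> (real \<Rightarrow> real) \<Rightarrow> real \<Rightarrow> real" where
  "K a f x = (LINT y|lebesgue_on {a..x}. f y)"

definition K_adj :: "real \<Rightarrow> (real \<Rightarrow> real) \<Rightarrow> real \<Rightarrow> real" where
  "K_adj b f x = (LINT y|lebesgue_on {x..b}. f y)"

definition set_sum :: "(real \<Rightarrow> real) set \<Rightarrow> (real \<Rightarrow> real) set \<Rightarrow> (real \<Rightarrow> real) set" where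
  "set_sum A B = {(\<lambda>x. f x + g x) | f g. f \<in> A \<and> g \<in> B}"

text \<open>
  \<open>polys a b 0\<close> is closed under a.e. equality, hence so are these sums: equality of two such
  sets of functions is equality of the corresponding subspaces of \<open>L\<^sup>2(a,b)\<close>.
\<close>

primrec Zspace :: "real \<Rightarrow> real \<Rightarrow> (real \<Rightarrow> real) set \<Rightarrow> nat \<Rightarrow> (real \<Rightarrow> real) set" where
  "Zspace a b Z0 0 = Z0"
| "Zspace a b Z0 (Suc t) = set_sum (polys a b 0) (K a ` Zspace a b Z0 t)"

definition orth_proj ::
    "real \<Rightarrow> real \<Rightarrow> (real \<Rightarrow> real) set \<Rightarrow> (real \<Rightarrow> real) \<Rightarrow> real \<Rightarrow> real" where
  "orth_proj a b V u = (SOME v. v \<in> V \<and> (\<forall>w\<in>V. ip a b (\<lambda>x. u x - v x) w = 0))"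

text \<open>In \<open>Qproj\<close> and \<open>ritz\<close> the order \<open>q\<close> comes before \<open>t\<close>; only \<open>q \<le> t\<close> is meaningful.\<close>

primrec Qproj ::
    "real \<Rightarrow> real \<Rightarrow> (real \<Rightarrow> real) set \<Rightarrow> nat \<Rightarrow> nat \<Rightarrow> (real \<Rightarrow> real) \<Rightarrow> real \<Rightarrow> real" where
  "Qproj a b Z0 0 t u = orth_proj a b (Zspace a b Z0 t) u"
| "Qproj a b Z0 (Suc q) t u =
     (\<lambda>x. point_value a b u a + K a (Qproj a b Z0 q (t - 1) (weak_deriv a b 1 u)) x)"

definition ritz ::
    "real \<Rightarrow> real \<Rightarrow> (real \<Rightarrow> real) set \<Rightarrow> nat \<Rightarrow> nat \<Rightarrow> (real \<Rightarrow> real) \<Rightarrow> real \<Rightarrow> real" where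
  "ritz a b Z0 q t u = (SOME r. r \<in> Zspace a b Z0 t \<and>
     (\<forall>v\<in>Zspace a b Z0 t.
        ip a b (weak_deriv a b q r) (weak_deriv a b q v) =
        ip a b (weak_deriv a b q u) (weak_deriv a b q v)) \<and>
     (\<forall>g\<in>polys a b (int q - 1). ip a b r g = ip a b u g))"

definition d_coeff :: "nat \<Rightarrow> real" where
  "d_coeff i = sqrt (real (i * (i + 1) * (i + 2) * (i + 3)) / 2)"

end

theory Submission
  imports Defs
begin

text \<open>
  Every \<open>v \<in> Z\<^sub>t\<close> is, up to a polynomial of degree less than \<open>q\<close>, a \<open>q\<close>-fold integral of its
  \<open>q\<close>-th weak derivative, which lies in \<open>Z\<^sub>t\<^sub>-\<^sub>q\<close>.  Both \<open>\<partial>\<^sup>q R u\<close> and \<open>\<partial>\<^sup>q Q u\<close> are the orthogonal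
  projection of \<open>\<partial>\<^sup>q u\<close> onto \<open>Z\<^sub>t\<^sub>-\<^sub>q\<close>, so \<open>e = R u - Q u\<close> is a polynomial of degree less than \<open>q\<close>.
  The second defining property of \<open>R\<close> then says that \<open>e\<close> is the orthogonal projection of \<open>u - Q u\<close>
  onto these polynomials, which gives the first bound.  The bounds for the derivatives follow by
  iterating the inequality \<open>\<parallel>p'\<parallel> \<le> d\<^sub>n / (b - a) \<parallel>p\<parallel>\<close> for polynomials of degree at most \<open>n\<close>.
  For its proof, \<open>p\<close> is split into an even and an odd part about the midpoint of \<open>[a,b]\<close>, and each
  part is expanded in Legendre polynomials of its own parity: the derivatives of these satisfy
  \<open>(b - a)\<^sup>2 \<parallel>L\<^sub>n'\<parallel>\<^sup>2 = 2 n (n + 1) (2 n + 1) \<parallel>L\<^sub>n\<parallel>\<^sup>2\<close>, and \<open>d\<^sub>n\<^sup>2\<close> is the sum of these factors over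
  \<open>n, n - 2, n - 4, \<dots>\<close>.
\<close>

section \<open>The space of square integrable functions\<close>

text \<open>\<open>ritz\<close>, \<open>orth_proj\<close> and \<open>weak_deriv\<close> are choices
  made by \<open>SOME\<close>, so nothing is known about them until existence is proved and, for the
  weak derivative, uniqueness almost everywhere. Uniqueness is the fundamental lemma of the calculus
  of variations and needs a supply of test functions, which are built from exp(-1/y). Existence of
  the Ritz projection comes from \<open>Qproj\<close>: adding to Q u the L^2 projection of u - Q u
  onto the polynomials of degree less than q leaves the q-th derivative alone and corrects the
  moments. In the inequality for p', derivatives of Legendre polynomials of equal parity are in
  general not orthogonal to each other. For p = sum c_k L_k and s_k = 2 k (k + 1) (2 k + 1), the
  Cauchy-Schwarz inequality with weights s_k gives (b - a)^2 ||p'||^2 <= (sum s_k) ||p||^2; this is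
  how a sum of the factors arises. The parity splitting keeps every second index out of that sum:
  even and odd parts are orthogonal, and so are their derivatives, hence the two bounds add and the
  larger constant serves both.\<close>

lemma integrable_lebesgue_on_iff:
  fixes f :: "real \<Rightarrow> real"
  assumes "S \<in> sets lebesgue"
  shows "integrable (lebesgue_on S) f \<longleftrightarrow> integrable lebesgue (\<lambda>x. indicator S x * f x)"
  using assms by (simp add: integrable_restrict_space)

lemma integral_lebesgue_on_eq:
  fixes f :: "real \<Rightarrow> real"
  assumes "S \<in> sets lebesgue"
  shows "(LINT x|lebesgue_on S. f x) = (LINT x|lebesgue. indicator S x * f x)"
  using assms by (simp add: integral_restrict_space)

lemma integrable_lebesgue_on_subset:
  fixes f :: "real \<Rightarrow> real"
  assumes "integrable (lebesgue_on T) f" "S \<subseteq> T" "S \<in> sets lebesgue" "T \<in> sets lebesgue"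
  shows "integrable (lebesgue_on S) f"
proof -
  have eq: "(\<lambda>x. indicator S x * f x) = (\<lambda>x. indicator S x *\<^sub>R (indicator T x * f x))"
    using assms(2) by (auto simp: indicator_def fun_eq_iff)
  have "integrable lebesgue (\<lambda>x. indicator S x *\<^sub>R (indicator T x * f x))"
    using assms by (intro integrable_mult_indicator) (simp_all add: integrable_lebesgue_on_iff)
  then show ?thesis
    using assms by (simp only: integrable_lebesgue_on_iff eq)
qed

lemma AE_lebesgue_neq: "AE x in lebesgue. x \<noteq> (c::real)"
  by (rule AE_I'[of "{c}"]) auto

text \<open>The endpoints form a null set. This lets results on compact intervals (continuity, gauge
  integrals) serve the open interval on which \<open>leb\<close> lives.\<close>

lemma integrable_leb_iff_closed:
  fixes f :: "real \<Rightarrow> real"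
  shows "integrable (leb a b) f \<longleftrightarrow> integrable (lebesgue_on {a..b}) f"
proof -
  have ae: "AE x in lebesgue. indicator {a<..<b} x * f x = indicator {a..b} x * f x"
    using AE_lebesgue_neq[of a] AE_lebesgue_neq[of b]
    by eventually_elim (auto simp: indicator_def)
  show ?thesis
  proof
    assume "integrable (leb a b) f"
    then have i: "integrable lebesgue (\<lambda>x. indicator {a<..<b} x * f x)"
      by (simp add: integrable_lebesgue_on_iff)
    have m: "(\<lambda>x. indicator {a..b} x * f x) \<in> borel_measurable lebesgue"
      by (rule borel_measurable_AE[OF borel_measurable_integrable[OF i] ae])
    show "integrable (lebesgue_on {a..b}) f"
      using i m ae by (auto simp: integrable_lebesgue_on_iff intro: integrable_cong_AE_imp)
  next
    assume "integrable (lebesgue_on {a..b}) f"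
    then show "integrable (leb a b) f"
      by (rule integrable_lebesgue_on_subset) auto
  qed
qed

section \<open>Equality almost everywhere and its compatibility with integrals\<close>

lemma ae_eq_refl [simp]: "ae_eq a b f f"
  by (simp add: ae_eq_def)

lemma ae_eq_sym: "ae_eq a b f g \<Longrightarrow> ae_eq a b g f"
  by (auto simp: ae_eq_def)

lemma ae_eq_trans: "ae_eq a b f g \<Longrightarrow> ae_eq a b g h \<Longrightarrow> ae_eq a b f h"
  unfolding ae_eq_def by (auto elim: eventually_elim2)

lemma ae_eq_add: "ae_eq a b f g \<Longrightarrow> ae_eq a b f' g' \<Longrightarrow> ae_eq a b (\<lambda>x. f x + f' x) (\<lambda>x. g x + g' x)"
  unfolding ae_eq_def by (auto elim: eventually_elim2)

lemma ae_eq_diff: "ae_eq a b f g \<Longrightarrow> ae_eq a b f' g' \<Longrightarrow> ae_eq a b (\<lambda>x. f x - f' x) (\<lambda>x. g x - g' x)"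
  unfolding ae_eq_def by (auto elim: eventually_elim2)

lemma ae_eq_cmult: "ae_eq a b f g \<Longrightarrow> ae_eq a b (\<lambda>x. c * f x) (\<lambda>x. c * g x)"
  unfolding ae_eq_def by (auto elim: eventually_mono)

lemma ae_eqI: "(\<And>x. a < x \<Longrightarrow> x < b \<Longrightarrow> f x = g x) \<Longrightarrow> ae_eq a b f g"
  unfolding ae_eq_def by (rule AE_I2) auto

text \<open>Lebesgue measure is complete; the functions are extended by zero to the whole line to
  use this.\<close>

lemma measurable_ae_eq:
  assumes "f \<in> borel_measurable (leb a b)" "ae_eq a b f g"
  shows "g \<in> borel_measurable (leb a b)"
proof -
  have "(\<lambda>x. if x \<in> {a<..<b} then f x else 0) \<in> borel_measurable lebesgue"
    using assms(1) by (intro borel_measurable_if_I) auto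
  moreover have "AE x in lebesgue. (if x \<in> {a<..<b} then f x else 0) = (if x \<in> {a<..<b} then g x else 0)"
    using assms(2) unfolding ae_eq_def by (subst (asm) AE_restrict_space_iff) (auto elim: eventually_mono)
  ultimately have "(\<lambda>x. if x \<in> {a<..<b} then g x else 0) \<in> borel_measurable lebesgue"
    by (rule borel_measurable_AE)
  then show ?thesis by (rule borel_measurable_if_D)
qed

lemma integrable_ae_eq:
  assumes "integrable (leb a b) f" "ae_eq a b f g"
  shows "integrable (leb a b) g"
proof (rule integrable_cong_AE_imp[OF assms(1)])
  show "g \<in> borel_measurable (leb a b)"
    by (rule measurable_ae_eq[OF borel_measurable_integrable[OF assms(1)] assms(2)])
  show "AE x in leb a b. f x = g x"
    using assms(2) by (simp add: ae_eq_def)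
qed

lemma integral_ae_eq:
  assumes "f \<in> borel_measurable (leb a b)" "ae_eq a b f g"
  shows "integral\<^sup>L (leb a b) f = integral\<^sup>L (leb a b) g"
  using assms measurable_ae_eq[OF assms] unfolding ae_eq_def by (intro integral_cong_AE)

lemma L2_measurable: "f \<in> L2 a b \<Longrightarrow> f \<in> borel_measurable (leb a b)"
  by (simp add: L2_def)

lemma L2_mult_integrable:
  assumes "f \<in> L2 a b" "g \<in> L2 a b"
  shows "integrable (leb a b) (\<lambda>x. f x * g x)"
proof (rule Bochner_Integration.integrable_bound)
  show "integrable (leb a b) (\<lambda>x. (f x)\<^sup>2 + (g x)\<^sup>2)"
    using assms by (intro Bochner_Integration.integrable_add) (auto simp: L2_def)
  show "(\<lambda>x. f x * g x) \<in> borel_measurable (leb a b)"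
    using assms by (intro borel_measurable_times) (auto simp: L2_def)
  have "\<bar>f x * g x\<bar> \<le> (f x)\<^sup>2 + (g x)\<^sup>2" for x
    using sum_squares_bound[of "\<bar>f x\<bar>" "\<bar>g x\<bar>"] mult_nonneg_nonneg[of "\<bar>f x\<bar>" "\<bar>g x\<bar>"]
    unfolding abs_mult power2_abs by linarith
  then show "AE x in leb a b. norm (f x * g x) \<le> norm ((f x)\<^sup>2 + (g x)\<^sup>2)"
    by auto
qed

lemma L2_ae_eq:
  assumes "f \<in> L2 a b" "ae_eq a b f g"
  shows "g \<in> L2 a b"
proof -
  have "ae_eq a b (\<lambda>x. (f x)\<^sup>2) (\<lambda>x. (g x)\<^sup>2)"
    using assms(2) unfolding ae_eq_def by (auto elim: eventually_mono)
  then show ?thesis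
    using assms measurable_ae_eq integrable_ae_eq unfolding L2_def by blast
qed

lemma L2_zero [simp]: "(\<lambda>x. 0) \<in> L2 a b"
  by (simp add: L2_def)

lemma L2_cmult: "f \<in> L2 a b \<Longrightarrow> (\<lambda>x. c * f x) \<in> L2 a b"
  by (auto simp: L2_def power_mult_distrib)

lemma L2_add:
  assumes "f \<in> L2 a b" "g \<in> L2 a b"
  shows "(\<lambda>x. f x + g x) \<in> L2 a b"
proof -
  have "integrable (leb a b) (\<lambda>x. (f x)\<^sup>2 + (g x)\<^sup>2 + 2 * (f x * g x))"
    using assms L2_mult_integrable[OF assms]
    by (intro Bochner_Integration.integrable_add integrable_mult_right) (auto simp: L2_def)
  then have "integrable (leb a b) (\<lambda>x. (f x + g x)\<^sup>2)"
    by (simp add: power2_sum mult.assoc)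
  then show ?thesis using assms by (auto simp: L2_def)
qed

lemma L2_diff:
  assumes "f \<in> L2 a b" "g \<in> L2 a b"
  shows "(\<lambda>x. f x - g x) \<in> L2 a b"
  using L2_add[OF assms(1) L2_cmult[OF assms(2), of "-1"]] by simp

lemma L2_sum:
  assumes "finite B" "\<And>g. g \<in> B \<Longrightarrow> F g \<in> L2 a b"
  shows "(\<lambda>x. \<Sum>g\<in>B. F g x) \<in> L2 a b"
  using assms by (induction B rule: finite_induct) (auto intro: L2_add)

lemma L2_continuous:
  assumes "continuous_on {a..b} f"
  shows "f \<in> L2 a b"
proof -
  have "integrable (leb a b) f" "integrable (leb a b) (\<lambda>x. (f x)\<^sup>2)"
    using assms by (auto simp: integrable_leb_iff_closed intro!: continuous_imp_integrable_real continuous_intros)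
  then show ?thesis by (auto simp: L2_def dest: borel_measurable_integrable)
qed

lemma L2_integrable: "f \<in> L2 a b \<Longrightarrow> integrable (leb a b) f"
  using L2_mult_integrable[OF _ L2_continuous[of a b "\<lambda>x. 1"]] by simp

section \<open>The inner product on representatives\<close>

lemma ip_commute: "ip a b f g = ip a b g f"
  by (simp add: ip_def mult.commute)

lemma ip_add_left:
  "f \<in> L2 a b \<Longrightarrow> g \<in> L2 a b \<Longrightarrow> h \<in> L2 a b \<Longrightarrow>
   ip a b (\<lambda>x. f x + g x) h = ip a b f h + ip a b g h"
  by (simp add: ip_def distrib_right L2_mult_integrable)

lemma ip_cmult_left: "ip a b (\<lambda>x. c * f x) h = c * ip a b f h"
  by (simp add: ip_def mult.assoc)

lemma ip_diff_left:
  "f \<in> L2 a b \<Longrightarrow> g \<in> L2 a b \<Longrightarrow> h \<in> L2 a b \<Longrightarrow>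
   ip a b (\<lambda>x. f x - g x) h = ip a b f h - ip a b g h"
  by (simp add: ip_def left_diff_distrib L2_mult_integrable)

lemma ip_ae_eq:
  assumes "f \<in> L2 a b" "g \<in> L2 a b" "ae_eq a b f f'" "ae_eq a b g g'"
  shows "ip a b f g = ip a b f' g'"
  unfolding ip_def
proof (rule integral_ae_eq)
  show "(\<lambda>x. f x * g x) \<in> borel_measurable (leb a b)"
    using assms by (intro borel_measurable_times) (auto simp: L2_def)
  show "ae_eq a b (\<lambda>x. f x * g x) (\<lambda>x. f' x * g' x)"
    using assms(3,4) unfolding ae_eq_def by (auto elim: eventually_elim2)
qed

lemma ip_self_nonneg: "0 \<le> ip a b f f"
  by (simp add: ip_def)

lemma nrm_ae_eq: "f \<in> L2 a b \<Longrightarrow> ae_eq a b f g \<Longrightarrow> nrm a b f = nrm a b g"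
  using ip_ae_eq[of f a b f g g] by (simp add: nrm_def)

lemma ip_self_eq_0:
  assumes "f \<in> L2 a b"
  shows "ip a b f f = 0 \<longleftrightarrow> ae_eq a b f (\<lambda>x. 0)"
  unfolding ip_def ae_eq_def
  using L2_mult_integrable[OF assms assms]
  by (subst integral_nonneg_eq_0_iff_AE) auto

text \<open>The degenerate case of the Cauchy-Schwarz inequality: \<open>f\<close> is null, so it
  can be replaced by zero.\<close>

lemma ip_eq_0_right:
  assumes "f \<in> L2 a b" "ip a b f f = 0" "g \<in> L2 a b"
  shows "ip a b g f = 0"
  using ip_ae_eq[OF assms(3,1) ae_eq_refl, of "\<lambda>x. 0"] assms
  by (simp add: ip_self_eq_0) (simp add: ip_def)

lemma L2_subspaceD:
  assumes "L2_subspace a b V"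
  shows "V \<subseteq> L2 a b" "(\<lambda>x. 0) \<in> V" "f \<in> V \<Longrightarrow> g \<in> V \<Longrightarrow> (\<lambda>x. f x + g x) \<in> V"
    "f \<in> V \<Longrightarrow> (\<lambda>x. c * f x) \<in> V" "f \<in> V \<Longrightarrow> ae_eq a b f g \<Longrightarrow> g \<in> V"
proof -
  show sub: "V \<subseteq> L2 a b" and "(\<lambda>x. 0) \<in> V"
    using assms by (simp_all add: L2_subspace_def)
  show "f \<in> V \<Longrightarrow> g \<in> V \<Longrightarrow> (\<lambda>x. f x + g x) \<in> V" "f \<in> V \<Longrightarrow> (\<lambda>x. c * f x) \<in> V"
    using assms by (simp_all add: L2_subspace_def)
  show "g \<in> V" if "f \<in> V" "ae_eq a b f g"
    using assms that sub L2_ae_eq[of f a b g] by (auto simp: L2_subspace_def)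
qed

lemma L2_subspace_diff:
  assumes "L2_subspace a b V" "f \<in> V" "g \<in> V"
  shows "(\<lambda>x. f x - g x) \<in> V"
  using L2_subspaceD(3)[OF assms(1,2) L2_subspaceD(4)[OF assms(1,3), of "-1"]] by simp

text \<open>A Gram-Schmidt argument by induction on the spanning set. The elements of
  \<open>B\<close> need not lie in \<open>V\<close>, so \<open>V\<close> has to vary: removing
  \<open>h\<close> from \<open>B\<close> cuts out a subspace of \<open>V\<close> of codimension at
  most one, and at most one orthogonal direction \<open>w0\<close> is added back.\<close>

lemma L2_projection_exists_aux:
  assumes "finite B" "B \<subseteq> L2 a b" "L2_subspace a b V"
    "\<forall>f\<in>V. \<exists>c. ae_eq a b f (\<lambda>x. \<Sum>g\<in>B. c g * g x)" "u \<in> L2 a b"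
  shows "\<exists>v\<in>V. \<forall>w\<in>V. ip a b (\<lambda>x. u x - v x) w = 0"
  using assms
proof (induction B arbitrary: V u rule: finite_induct)
  case empty
  have "ip a b (\<lambda>x. u x - 0) w = 0" if "w \<in> V" for w
  proof -
    have "ae_eq a b w (\<lambda>x. 0)" "w \<in> L2 a b"
      using empty that L2_subspaceD(1)[OF empty(2)] by auto
    then show ?thesis using ip_eq_0_right[of w a b u] ip_self_eq_0[of w a b] empty(4) by simp
  qed
  then show ?case by (intro bexI[OF ballI L2_subspaceD(2)[OF empty(2)]])
next
  case (insert h B)
  note V = L2_subspaceD[OF insert.prems(2)]
  define V' where "V' = {v \<in> V. \<exists>c. ae_eq a b v (\<lambda>x. \<Sum>g\<in>B. c g * g x)}"
  have V'I: "v \<in> V'" if "v \<in> V" "ae_eq a b v (\<lambda>x. \<Sum>g\<in>B. c g * g x)" for v c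
    unfolding V'_def by (intro CollectI conjI exI[of _ c] that)
  have V'E: thesis if "v \<in> V'" "\<And>c. v \<in> V \<Longrightarrow> ae_eq a b v (\<lambda>x. \<Sum>g\<in>B. c g * g x) \<Longrightarrow> thesis" for v thesis
  proof -
    from that(1) obtain c where "v \<in> V" "ae_eq a b v (\<lambda>x. \<Sum>g\<in>B. c g * g x)"
      unfolding V'_def by auto
    then show thesis by (rule that(2))
  qed
  have V': "L2_subspace a b V'"
    unfolding L2_subspace_def
  proof (intro conjI ballI allI impI)
    show "V' \<subseteq> L2 a b" using V(1) by (auto simp: V'_def)
    show "(\<lambda>x. 0) \<in> V'" by (rule V'I[OF V(2), of "\<lambda>g. 0"]) simp
  next
    fix f g assume "f \<in> V'" "g \<in> V'"
    then obtain c d where *: "f \<in> V" "g \<in> V" "ae_eq a b f (\<lambda>x. \<Sum>g\<in>B. c g * g x)"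
       "ae_eq a b g (\<lambda>x. \<Sum>g\<in>B. d g * g x)" by (elim V'E)
    have "ae_eq a b (\<lambda>x. f x + g x) (\<lambda>x. \<Sum>g\<in>B. (c g + d g) * g x)"
      using ae_eq_add[OF *(3,4)] by (simp add: sum.distrib distrib_right)
    then show "(\<lambda>x. f x + g x) \<in> V'"
      by (intro V'I[of _ "\<lambda>g. c g + d g"] V(3) *(1,2))
  next
    fix k f assume "f \<in> V'"
    then obtain c where *: "f \<in> V" "ae_eq a b f (\<lambda>x. \<Sum>g\<in>B. c g * g x)" by (elim V'E)
    have "ae_eq a b (\<lambda>x. k * f x) (\<lambda>x. \<Sum>g\<in>B. (k * c g) * g x)"
      using ae_eq_cmult[OF *(2), of k] by (simp add: sum_distrib_left mult.assoc)
    then show "(\<lambda>x. k * f x) \<in> V'"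
      by (intro V'I[of _ "\<lambda>g. k * c g"] V(4) *(1))
  next
    fix f g assume *: "f \<in> V'" "ae_eq a b f g"
    then obtain c where c: "f \<in> V" "ae_eq a b f (\<lambda>x. \<Sum>g\<in>B. c g * g x)" by (elim V'E)
    show "g \<in> V'"
      by (rule V'I[OF V(5)[OF c(1) *(2)] ae_eq_trans[OF ae_eq_sym[OF *(2)] c(2)]])
  qed
  have V'sub: "V' \<subseteq> V" by (auto simp: V'_def)
  have BL: "B \<subseteq> L2 a b" using insert.prems by auto
  have spanV': "\<forall>f\<in>V'. \<exists>c. ae_eq a b f (\<lambda>x. \<Sum>g\<in>B. c g * g x)" by (simp add: V'_def)
  have proj': "\<exists>v\<in>V'. \<forall>w\<in>V'. ip a b (\<lambda>x. u x - v x) w = 0" if "u \<in> L2 a b" for u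
    by (rule insert.IH[OF BL V' spanV' that])
  obtain p where p: "p \<in> V'" "\<And>w. w \<in> V' \<Longrightarrow> ip a b (\<lambda>x. u x - p x) w = 0"
    using proj'[OF insert.prems(4)] by auto
  show ?case
  proof (cases "V = V'")
    case True
    then show ?thesis by (intro bexI[of _ p] ballI) (use p in auto)
  next
    case False
    then obtain v0 where v0: "v0 \<in> V" "v0 \<notin> V'" using V'sub by blast
    have v0L: "v0 \<in> L2 a b" using v0 V(1) by blast
    obtain c0 where c0: "ae_eq a b v0 (\<lambda>x. \<Sum>g\<in>insert h B. c0 g * g x)"
      using bspec[OF insert.prems(3) v0(1)] by (rule exE)
    \<comment> \<open>Otherwise \<open>v0\<close> would be spanned by \<open>B\<close> alone and
      belong to \<open>V'\<close>.\<close>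
    have "c0 h \<noteq> 0"
    proof
      assume "c0 h = 0"
      then have "ae_eq a b v0 (\<lambda>x. \<Sum>g\<in>B. c0 g * g x)"
        using c0 insert.hyps by simp
      from V'I[OF v0(1) this] v0(2) show False by contradiction
    qed
    obtain p0 where p0: "p0 \<in> V'" "\<And>w. w \<in> V' \<Longrightarrow> ip a b (\<lambda>x. v0 x - p0 x) w = 0"
      using proj'[OF v0L] by auto
    define w0 where "w0 = (\<lambda>x. v0 x - p0 x)"
    have w0: "w0 \<in> V" unfolding w0_def
      using L2_subspace_diff[OF insert.prems(2)] v0(1) p0(1) V'sub by blast
    have w0L: "w0 \<in> L2 a b" using w0 V(1) by blast
    have w0orth: "ip a b w0 w = 0" if "w \<in> V'" for w using p0(2)[OF that] by (simp add: w0_def)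
    \<comment> \<open>If \<open>w0\<close> is null, division by zero gives \<open>s = 0\<close>; the
      next identity still holds, since then \<open>ip a b u w0\<close> vanishes too.\<close>
    define s where "s = ip a b u w0 / ip a b w0 w0"
    have s: "ip a b u w0 = s * ip a b w0 w0"
      using ip_eq_0_right[OF w0L _ insert.prems(4)] by (auto simp: s_def)
    define v where "v = (\<lambda>x. p x + s * w0 x)"
    have pV: "p \<in> V" and pL: "p \<in> L2 a b" using p(1) V'sub V(1) by auto
    have vV: "v \<in> V" unfolding v_def by (intro V(3) V(4) pV w0)
    have uvL: "(\<lambda>x. u x - v x) \<in> L2 a b"
      using vV V(1) insert.prems(4) by (auto intro: L2_diff)
    have uv: "ip a b (\<lambda>x. u x - v x) w = ip a b (\<lambda>x. u x - p x) w - s * ip a b w0 w"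
      if "w \<in> L2 a b" for w
    proof -
      have eq: "(\<lambda>x. u x - v x) = (\<lambda>x. (u x - p x) - s * w0 x)" by (simp add: v_def fun_eq_iff)
      show ?thesis unfolding eq
        using that insert.prems(4) pL w0L by (simp add: ip_diff_left L2_diff L2_cmult ip_cmult_left)
    qed
    have orth0: "ip a b (\<lambda>x. u x - v x) w0 = 0"
      using uv[OF w0L] s w0orth[OF p(1)] insert.prems(4) pL w0L ip_commute[of a b p w0]
      by (simp add: ip_diff_left)
    have orth': "ip a b (\<lambda>x. u x - v x) w = 0" if "w \<in> V'" for w
      using uv p(2)[OF that] w0orth[OF that] that V'sub V(1) by auto
    \<comment> \<open>A multiple of \<open>v0\<close> cancels the \<open>h\<close>-coordinate of any
      \<open>w\<close>, so \<open>V\<close> is \<open>V'\<close> plus the line through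
      \<open>w0\<close>.\<close>
    have *: "\<exists>k. \<exists>v'\<in>V'. w = (\<lambda>x. v' x + k * w0 x)" if wV: "w \<in> V" for w
    proof -
      obtain c where c: "ae_eq a b w (\<lambda>x. \<Sum>g\<in>insert h B. c g * g x)"
        using bspec[OF insert.prems(3) wV] by (rule exE)
      define k where "k = c h / c0 h"
      have "ae_eq a b (\<lambda>x. w x - k * v0 x) (\<lambda>x. (\<Sum>g\<in>insert h B. c g * g x) - k * (\<Sum>g\<in>insert h B. c0 g * g x))"
        by (intro ae_eq_diff ae_eq_cmult c c0)
      also have "(\<lambda>x. (\<Sum>g\<in>insert h B. c g * g x) - k * (\<Sum>g\<in>insert h B. c0 g * g x)) = (\<lambda>x. \<Sum>g\<in>B. (c g - k * c0 g) * g x)"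
        using insert.hyps \<open>c0 h \<noteq> 0\<close>
        by (simp add: fun_eq_iff k_def algebra_simps sum_subtractf sum_distrib_left)
      finally have *: "(\<lambda>x. w x - k * v0 x) \<in> V'"
        by (intro V'I[of _ "\<lambda>g. c g - k * c0 g"] L2_subspace_diff[OF insert.prems(2)] V(4) wV v0(1))
      have "(\<lambda>x. (w x - k * v0 x) + k * p0 x) \<in> V'"
        by (intro L2_subspaceD(3)[OF V'] L2_subspaceD(4)[OF V'] * p0(1))
      then show ?thesis
        by (intro exI[of _ k] bexI[of _ "\<lambda>x. (w x - k * v0 x) + k * p0 x"]) (auto simp: w0_def algebra_simps)
    qed
    have lin: "ip a b (\<lambda>x. u x - v x) (\<lambda>x. v' x + k * w0 x) =
        ip a b (\<lambda>x. u x - v x) v' + k * ip a b (\<lambda>x. u x - v x) w0" if "v' \<in> V'" for k v'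
      using ip_add_left[of v' a b "\<lambda>x. k * w0 x" "\<lambda>x. u x - v x"] that V'sub V(1) w0L uvL
      by (auto simp: L2_cmult ip_cmult_left ip_commute[of a b "\<lambda>x. u x - v x"])
    have "ip a b (\<lambda>x. u x - v x) w = 0" if wV: "w \<in> V" for w
    proof -
      obtain k v' where "v' \<in> V'" "w = (\<lambda>x. v' x + k * w0 x)" using *[OF wV] by auto
      then show ?thesis using orth0 orth' lin by simp
    qed
    then show ?thesis by (intro bexI[OF ballI vV])
  qed
qed

lemma L2_projection_exists:
  assumes "L2_subspace a b V" "L2_finite_dim a b V" "u \<in> L2 a b"
  obtains v where "v \<in> V" "\<And>w. w \<in> V \<Longrightarrow> ip a b (\<lambda>x. u x - v x) w = 0"
proof -
  obtain B where "finite B" "B \<subseteq> L2 a b" "\<forall>f\<in>V. \<exists>c. ae_eq a b f (\<lambda>x. \<Sum>g\<in>B. c g * g x)"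
    using assms(2) unfolding L2_finite_dim_def by auto
  from L2_projection_exists_aux[OF this(1,2) assms(1) this(3) assms(3)] show ?thesis
    using that by auto
qed

text \<open>An indexed family may repeat functions while a spanning set cannot, so the coefficients
  of all indices with the same function are added up.\<close>

lemma L2_finite_dimI:
  assumes "finite I" "\<And>i. i \<in> I \<Longrightarrow> F i \<in> L2 a b"
    "\<And>f. f \<in> V \<Longrightarrow> \<exists>c. ae_eq a b f (\<lambda>x. \<Sum>i\<in>I. c i * F i x)"
  shows "L2_finite_dim a b V"
  unfolding L2_finite_dim_def
proof (intro exI[of _ "F ` I"] conjI ballI)
  fix f assume "f \<in> V"
  then obtain c where c: "ae_eq a b f (\<lambda>x. \<Sum>i\<in>I. c i * F i x)" using assms(3) by auto
  have "(\<Sum>g\<in>F ` I. (\<Sum>i | i \<in> I \<and> F i = g. c i) * g x) = (\<Sum>i\<in>I. c i * F i x)" for x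
  proof -
    have "(\<Sum>g\<in>F ` I. (\<Sum>i | i \<in> I \<and> F i = g. c i) * g x) =
        (\<Sum>g\<in>F ` I. \<Sum>i | i \<in> I \<and> F i = g. c i * F i x)"
      by (intro sum.cong refl) (simp add: sum_distrib_right)
    also have "\<dots> = (\<Sum>i\<in>I. c i * F i x)" using assms(1) by (intro sum.group) auto
    finally show ?thesis .
  qed
  then show "\<exists>c. ae_eq a b f (\<lambda>x. \<Sum>g\<in>F ` I. c g * g x)"
    using c by (intro exI[of _ "\<lambda>g. \<Sum>i | i \<in> I \<and> F i = g. c i"]) simp
qed (use assms in auto)

section \<open>Integrals of polynomials\<close>

lemma integral_leb_eq_closed:
  fixes f :: "real \<Rightarrow> real"
  assumes "integrable (leb a b) f"
  shows "(LINT x|leb a b. f x) = integral {a..b} f"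
  using lebesgue_integral_eq_integral[OF assms] unfolding integral_open_interval_real by simp

lemma continuous_integrable_leb:
  fixes f :: "real \<Rightarrow> real"
  shows "continuous_on {a..b} f \<Longrightarrow> integrable (leb a b) f"
  by (rule L2_integrable[OF L2_continuous])

lemma integral_deriv_leb:
  fixes f :: "real \<Rightarrow> real"
  assumes "a < b" "\<And>x. x \<in> {a..b} \<Longrightarrow> (f has_real_derivative f' x) (at x)" "continuous_on {a..b} f'"
  shows "(LINT x|leb a b. f' x) = f b - f a"
proof -
  have "(f' has_integral (f b - f a)) {a..b}"
    using assms by (intro fundamental_theorem_of_calculus)
      (auto simp: has_real_derivative_iff_has_vector_derivative[symmetric] intro: has_field_derivative_at_within)
  then show ?thesis
    using integral_leb_eq_closed[OF continuous_integrable_leb[OF assms(3)]] by (simp add: integral_unique)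
qed

lemma poly_L2 [simp]: "poly p \<in> L2 a b"
  by (intro L2_continuous continuous_intros)

lemma poly_integrable [simp]: "integrable (leb a b) (poly p)"
  by (rule L2_integrable) simp

text \<open>As a linear functional on polynomials, the integral turns inner products into
  \<open>pint a b (p * q)\<close>, so the orthogonality arguments below become algebra in the
  polynomial ring.\<close>

definition pint :: "real \<Rightarrow> real \<Rightarrow> real poly \<Rightarrow> real" where
  "pint a b p = (LINT x|leb a b. poly p x)"

lemma ip_poly: "ip a b (poly p) (poly q) = pint a b (p * q)"
  by (simp add: ip_def pint_def)

lemma pint_add: "pint a b (p + q) = pint a b p + pint a b q"
  by (simp add: pint_def)

lemma pint_diff: "pint a b (p - q) = pint a b p - pint a b q"
  by (simp add: pint_def)

lemma pint_smult: "pint a b (smult c p) = c * pint a b p"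
  by (simp add: pint_def)

lemma pint_minus: "pint a b (- p) = - pint a b p"
  by (simp add: pint_def)

lemma pint_0 [simp]: "pint a b 0 = 0"
  by (simp add: pint_def)

lemmas pint_linear = pint_add pint_diff pint_smult pint_minus

lemma pint_square_lincomb:
  "pint a b ((smult c p + smult d q) * (smult c p + smult d q)) =
   c\<^sup>2 * pint a b (p * p) + 2 * (c * d * pint a b (p * q)) + d\<^sup>2 * pint a b (q * q)"
proof -
  have "(smult c p + smult d q) * (smult c p + smult d q) =
      smult (c * c) (p * p) + smult (c * d) (p * q) + (smult (c * d) (p * q) + smult (d * d) (q * q))"
    by (simp only: distrib_left distrib_right mult_smult_left mult_smult_right smult_smult smult_add_right mult.commute[of q p] mult.commute[of d c] add.assoc)
  from arg_cong[OF this, of "pint a b"] show ?thesis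
    by (simp only: pint_add pint_smult power2_eq_square)
qed

lemma pint_square_nonneg: "0 \<le> pint a b (p * p)"
  by (simp add: pint_def)

text \<open>A nonzero polynomial has finitely many roots, while the interval has positive measure.
  This makes \<open>pint\<close> of a square definite.\<close>

lemma poly_ae_eq_zero:
  assumes "a < b" "ae_eq a b (poly p) (\<lambda>x. 0)"
  shows "p = 0"
proof (rule ccontr)
  assume "p \<noteq> 0"
  then have "finite {x. poly p x = 0}" by (rule poly_roots_finite)
  then have "AE x in lebesgue. x \<notin> {x. poly p x = 0}"
    by (intro AE_not_in) (simp add: negligible_iff_null_sets[symmetric] negligible_finite)
  moreover have "AE x in lebesgue. x \<in> {a<..<b} \<longrightarrow> poly p x = 0"
    using assms(2) by (simp add: ae_eq_def AE_restrict_space_iff)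
  ultimately have "AE x in lebesgue. x \<notin> {a<..<b}" by eventually_elim auto
  then have "emeasure lebesgue {a<..<b} = 0"
    by (subst (asm) AE_iff_null) (auto simp: null_sets_def greaterThanLessThan_def greaterThan_def lessThan_def Int_def)
  then show False using assms(1) by simp
qed

lemma pint_square_eq_0:
  assumes "a < b" "pint a b (p * p) = 0"
  shows "p = 0"
  using assms(2) poly_ae_eq_zero[OF assms(1)] ip_self_eq_0[of "poly p" a b] by (simp add: ip_poly)

lemma pint_pderiv: "a < b \<Longrightarrow> pint a b (pderiv p) = poly p b - poly p a"
  unfolding pint_def by (intro integral_deriv_leb poly_DERIV continuous_intros)

lemma pint_by_parts:
  assumes "a < b"
  shows "pint a b (pderiv p * q) = poly p b * poly q b - poly p a * poly q a - pint a b (p * pderiv q)"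
  using pint_pderiv[OF assms, of "p * q"] unfolding pderiv_mult pint_add poly_mult mult.commute[of q] by linarith

lemma pderiv_surj: "\<exists>P :: real poly. pderiv P = p"
proof -
  have "pderiv (sum f A) = (\<Sum>i\<in>A. pderiv (f i))" for f :: "nat \<Rightarrow> real poly" and A
    by (induction A rule: infinite_finite_induct) (simp_all add: pderiv_add)
  then have "pderiv (\<Sum>i\<le>degree p. monom (coeff p i / real (Suc i)) (Suc i)) = (\<Sum>i\<le>degree p. monom (coeff p i) i)"
    by (simp add: pderiv_monom del: of_nat_Suc)
  then show ?thesis using poly_as_sum_of_monoms[of p] by metis
qed

section \<open>Reflection about the midpoint of [a,b], and parity\<close>

abbreviation reflect :: "real \<Rightarrow> real \<Rightarrow> real poly \<Rightarrow> real poly" where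
  "reflect a b p \<equiv> pcompose p [:a + b, - 1:]"

lemma pderiv_reflect: "pderiv (reflect a b p) = - reflect a b (pderiv p)"
  by (simp add: pderiv_pcompose pderiv_pCons)

lemma reflect_reflect: "reflect a b (reflect a b p) = p"
proof -
  have "reflect a b (reflect a b p) = pcompose p (pcompose [:a + b, - 1:] [:a + b, - 1:])"
    by (rule pcompose_assoc[symmetric])
  also have "pcompose [:a + b, - 1:] [:a + b, - 1:] = [:0, 1:]"
    by (simp add: pcompose_pCons)
  finally show ?thesis by simp
qed

lemma degree_reflect [simp]: "degree (reflect a b p) = degree p"
  by (simp add: degree_pcompose)

lemma lead_coeff_reflect: "lead_coeff (reflect a b p) = (- 1) ^ degree p * lead_coeff p"
  by (subst lead_coeff_comp) auto

text \<open>Instead of a change of variables: if P is an antiderivative of p, then minus the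
  reflected P is one of the reflected p, and reflection swaps the endpoint values.\<close>

lemma pint_reflect:
  assumes "a < b"
  shows "pint a b (reflect a b p) = pint a b p"
proof -
  obtain P where P: "pderiv P = p" using pderiv_surj by blast
  have "reflect a b p = pderiv (- reflect a b P)"
    by (simp add: pderiv_minus pderiv_reflect P)
  then show ?thesis
    using pint_pderiv[OF assms, of P] pint_pderiv[OF assms, of "- reflect a b P"] P
    by (simp add: poly_pcompose)
qed

lemma pint_reflect_mult:
  "a < b \<Longrightarrow> pint a b (reflect a b p * q) = pint a b (p * reflect a b q)"
  using pint_reflect[of a b "p * reflect a b q"] by (simp add: pcompose_mult reflect_reflect)

text \<open>Compare leading coefficients: reflection multiplies that of \<open>p\<close> by (-1) to
  the power \<open>degree p\<close>.\<close>

lemma parity_degree: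
  assumes "reflect a b p = smult ((- 1) ^ m) p" "p \<noteq> 0"
  shows "(- 1 :: real) ^ degree p = (- 1) ^ m"
  using arg_cong[OF assms(1), of "\<lambda>q. coeff q (degree p)"] lead_coeff_reflect[of p a b] assms(2)
  by simp

lemma parity_degree_less:
  assumes "reflect a b p = smult ((- 1) ^ Suc n) p" "degree p \<le> n" "p \<noteq> 0"
  shows "degree p < n"
  using parity_degree[OF assms(1,3)] assms(2) by (cases "degree p = n") auto

text \<open>Writing the bound as \<open>int n - 1\<close> turns it into \<open>degree p < n\<close>,
  which for \<open>n = 0\<close> leaves only the zero class.\<close>

lemma polys_iff:
  "f \<in> polys a b (int n - 1) \<longleftrightarrow> (\<exists>p. (p = 0 \<or> degree p < n) \<and> ae_eq a b f (poly p))"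
proof -
  have "f \<in> L2 a b" if "ae_eq a b f (poly p)" for p
    using L2_ae_eq[OF poly_L2 ae_eq_sym[OF that]] .
  moreover have "int (degree p) \<le> int n - 1 \<longleftrightarrow> degree p < n" for p :: "real poly" by linarith
  ultimately show ?thesis unfolding polys_def by auto
qed

lemma degree_less_add:
  fixes p q :: "real poly"
  shows "p = 0 \<or> degree p < n \<Longrightarrow> q = 0 \<or> degree q < n \<Longrightarrow> p + q = 0 \<or> degree (p + q) < n"
  using degree_add_less[of p n q] by auto

lemma L2_subspace_polys: "L2_subspace a b (polys a b (int n - 1))"
  unfolding L2_subspace_def
proof (intro conjI ballI allI impI)
  show "polys a b (int n - 1) \<subseteq> L2 a b" by (auto simp: polys_def)
  show "(\<lambda>x. 0) \<in> polys a b (int n - 1)"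
    unfolding polys_iff by (intro exI[of _ 0]) (simp add: ae_eqI)
next
  fix f g assume "f \<in> polys a b (int n - 1)" "g \<in> polys a b (int n - 1)"
  then obtain p q where "p = 0 \<or> degree p < n" "ae_eq a b f (poly p)" "q = 0 \<or> degree q < n" "ae_eq a b g (poly q)"
    unfolding polys_iff by blast
  then show "(\<lambda>x. f x + g x) \<in> polys a b (int n - 1)"
    unfolding polys_iff
    using degree_less_add[of p n q] ae_eq_add[of a b f "poly p" g "poly q"]
    by (intro exI[of _ "p + q"]) (simp add: poly_add[abs_def])
next
  fix c f assume "f \<in> polys a b (int n - 1)"
  then obtain p where "p = 0 \<or> degree p < n" "ae_eq a b f (poly p)"
    unfolding polys_iff by blast
  then show "(\<lambda>x. c * f x) \<in> polys a b (int n - 1)"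
    unfolding polys_iff using ae_eq_cmult[of a b f "poly p" c]
    by (intro exI[of _ "smult c p"]) (auto simp: poly_smult[abs_def] poly_0[abs_def])
next
  fix f g assume "f \<in> polys a b (int n - 1)" and fg: "ae_eq a b f g"
  then obtain p where p: "p = 0 \<or> degree p < n" "ae_eq a b f (poly p)"
    unfolding polys_iff by blast
  from ae_eq_trans[OF ae_eq_sym[OF fg] p(2)] p(1) show "g \<in> polys a b (int n - 1)"
    unfolding polys_iff by (intro exI[of _ p]) simp
qed

lemma L2_finite_dim_polys: "L2_finite_dim a b (polys a b (int n - 1))"
proof (rule L2_finite_dimI[of "{..<n}" "\<lambda>i x. x ^ i"])
  show "(\<lambda>x. x ^ i) \<in> L2 a b" for i
    by (intro L2_continuous continuous_intros)
  fix f assume "f \<in> polys a b (int n - 1)"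
  then obtain p where p: "p = 0 \<or> degree p < n" "ae_eq a b f (poly p)"
    unfolding polys_iff by blast
  have "poly p x = (\<Sum>i<n. coeff p i * x ^ i)" for x
  proof -
    have "poly p x = (\<Sum>i\<le>degree p. coeff p i * x ^ i)" by (rule poly_altdef)
    also have "\<dots> = (\<Sum>i<n. coeff p i * x ^ i)"
      using p(1) by (cases "p = 0") (auto intro!: sum.mono_neutral_left intro: le_degree)
    finally show ?thesis .
  qed
  then have "poly p = (\<lambda>x. \<Sum>i<n. coeff p i * x ^ i)" by (rule ext)
  then show "\<exists>c. ae_eq a b f (\<lambda>x. \<Sum>i<n. c i * x ^ i)"
    using p(2) by (intro exI[of _ "coeff p"]) simp
qed simp

section \<open>Legendre polynomials and a Markov inequality in the mean\<close>

text \<open>The Legendre polynomials transplanted to [a,b], determined only up to a nonzero factor: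
  both sides of the norm identity for \<open>pderiv L\<close> scale alike, so no normalisation is
  fixed.\<close>

definition legendre :: "real \<Rightarrow> real \<Rightarrow> nat \<Rightarrow> real poly \<Rightarrow> bool" where
  "legendre a b n L \<longleftrightarrow> degree L = n \<and> L \<noteq> 0 \<and> (\<forall>q. degree q < n \<longrightarrow> pint a b (L * q) = 0)"

text \<open>The monomial of degree n minus its orthogonal projection onto lower degrees; the leading
  coefficient 1 survives.\<close>

lemma legendre_exists: "\<exists>L. legendre a b n L"
proof -
  obtain v where v: "v \<in> polys a b (int n - 1)"
    "\<And>w. w \<in> polys a b (int n - 1) \<Longrightarrow> ip a b (\<lambda>x. poly (monom 1 n) x - v x) w = 0"
    using L2_projection_exists[OF L2_subspace_polys L2_finite_dim_polys poly_L2[of "monom 1 n"]] by metis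
  then obtain p where p: "p = 0 \<or> degree p < n" "ae_eq a b v (poly p)" unfolding polys_iff by blast
  define L where "L = monom 1 n - p"
  have c: "coeff L n = 1" using p(1) by (auto simp: L_def coeff_eq_0)
  have "degree L \<le> n" unfolding L_def using p(1) by (intro degree_diff_le) (auto simp: degree_monom_eq)
  moreover have "n \<le> degree L" using c by (intro le_degree) simp
  moreover have "pint a b (L * q) = 0" if "degree q < n" for q
  proof -
    have "poly q \<in> polys a b (int n - 1)" unfolding polys_iff using that ae_eq_refl by blast
    then have "0 = ip a b (\<lambda>x. poly (monom 1 n) x - v x) (poly q)" using v(2) by simp
    also have "\<dots> = ip a b (poly L) (poly q)"
    proof (rule ip_ae_eq)
      have "v \<in> L2 a b" using v(1) by (simp add: polys_def)
      then show "(\<lambda>x. poly (monom 1 n) x - v x) \<in> L2 a b" by (intro L2_diff) simp_all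
      show "ae_eq a b (\<lambda>x. poly (monom 1 n) x - v x) (poly L)"
        using ae_eq_diff[OF ae_eq_refl[of a b "poly (monom 1 n)"] p(2)] by (simp add: L_def poly_diff[abs_def])
    qed simp_all
    finally show ?thesis by (simp add: ip_poly)
  qed
  ultimately show ?thesis using c unfolding legendre_def by (intro exI[of _ L]) auto
qed

text \<open>Test \<open>M\<close> against itself. Identities for Legendre polynomials are proved by
  applying this to the difference of their two sides.\<close>

lemma legendre_unique_zero:
  assumes "a < b" "M = 0 \<or> degree M < n" "\<And>q. degree q < n \<Longrightarrow> pint a b (M * q) = 0"
  shows "M = 0"
  using assms(2) assms(3)[of M] pint_square_eq_0[OF assms(1), of M] by auto

lemma degree_less_if_coeff_0:
  "degree p \<le> n \<Longrightarrow> coeff p n = 0 \<Longrightarrow> p = 0 \<or> degree p < n"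
  by (cases "degree p = n") auto

text \<open>The leading terms of the two sides agree, and their difference stays orthogonal to lower
  degrees, because reflection is self-adjoint for \<open>pint\<close> and preserves degrees.\<close>

lemma legendre_reflect:
  assumes "a < b" "legendre a b n L"
  shows "reflect a b L = smult ((- 1) ^ n) L"
proof -
  have L: "degree L = n" "\<And>q. degree q < n \<Longrightarrow> pint a b (L * q) = 0"
    using assms(2) by (auto simp: legendre_def)
  define M where "M = reflect a b L - smult ((- 1) ^ n) L"
  have "M = 0"
  proof (rule legendre_unique_zero[OF assms(1), of _ n])
    have "degree M \<le> n" unfolding M_def by (intro degree_diff_le) (auto simp: L(1))
    moreover have "coeff M n = 0"
      using lead_coeff_reflect[of L a b] by (simp add: M_def L(1))
    ultimately show "M = 0 \<or> degree M < n" by (rule degree_less_if_coeff_0)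
    show "pint a b (M * q) = 0" if "degree q < n" for q
      using L(2)[of q] L(2)[of "reflect a b q"] that
      by (simp add: M_def left_diff_distrib pint_linear pint_reflect_mult[OF assms(1)])
  qed
  then show ?thesis by (simp add: M_def)
qed

text \<open>Legendre's differential equation on [a,b], with weight w = (x - a)(b - x). The operator
  q -> (w q')' does not raise degrees, multiplies the leading coefficient in degree n by -n (n + 1),
  and is symmetric because w vanishes at both ends. Hence it maps L to a polynomial with the same
  orthogonality.\<close>

lemma legendre_ode:
  assumes "a < b" "legendre a b n L"
  shows "pderiv ([:- a * b, a + b, - 1:] * pderiv L) = smult (- real (n * (n + 1))) L"
proof -
  define w where "w = [:- a * b, a + b, - 1:]"
  have L: "degree L = n" "\<And>q. degree q < n \<Longrightarrow> pint a b (L * q) = 0"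
    using assms(2) by (auto simp: legendre_def)
  have w: "poly w a = 0" "poly w b = 0" "degree w = 2" by (simp_all add: w_def algebra_simps)
  have deg: "degree (pderiv (w * pderiv q)) \<le> degree q" for q
  proof (cases "degree q = 0")
    case True
    then have "pderiv q = 0" by (simp add: pderiv_eq_0_iff)
    then show ?thesis by simp
  next
    case False
    have "degree (w * pderiv q) \<le> 2 + degree (pderiv q)"
      using degree_mult_le[of w "pderiv q"] w(3) by simp
    then show ?thesis using False by (simp add: degree_pderiv)
  qed
  define M where "M = pderiv (w * pderiv L) + smult (real (n * (n + 1))) L"
  have "M = 0"
  proof (rule legendre_unique_zero[OF assms(1), of _ n])
    have "degree M \<le> n" unfolding M_def using deg[of L] L(1) by (intro degree_add_le) auto
    moreover have "coeff M n = 0"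
      using coeff_eq_0[of L "Suc n"] coeff_eq_0[of L "Suc (Suc n)"]
      by (cases n) (simp_all add: M_def w_def coeff_pderiv coeff_pCons L(1) algebra_simps)
    ultimately show "M = 0 \<or> degree M < n" by (rule degree_less_if_coeff_0)
    show "pint a b (M * q) = 0" if "degree q < n" for q
    proof -
      \<comment> \<open>Two integrations by parts, without boundary terms, move the operator from L
        to q.\<close>
      have "pint a b (pderiv (w * pderiv L) * q) = - pint a b (w * pderiv L * pderiv q)"
        using pint_by_parts[OF assms(1), of "w * pderiv L" q] w by simp
      also have "\<dots> = - pint a b (pderiv L * (w * pderiv q))" by (simp only: mult_ac)
      also have "\<dots> = pint a b (L * pderiv (w * pderiv q))"
        using pint_by_parts[OF assms(1), of L "w * pderiv q"] w by simp
      also have "\<dots> = 0" using deg[of q] that by (intro L(2)) simp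
      finally show ?thesis using L(2)[OF that]
        by (simp add: M_def distrib_right pint_add pint_smult)
    qed
  qed
  then have "pderiv (w * pderiv L) = smult (- real (n * (n + 1))) L"
    unfolding M_def smult_minus_left eq_neg_iff_add_eq_0 .
  then show ?thesis unfolding w_def .
qed

text \<open>Both norms are tied to the boundary quantity S = L(a)^2 + L(b)^2: integrating L' L' by
  parts gives (b - a) ||L'||^2 = n (n + 1) S, and integrating the derivative of (2 x - a - b) L^2
  gives (b - a) S = (4 n + 2) ||L||^2.\<close>

lemma legendre_pderiv_norm:
  assumes "a < b" "legendre a b n L"
  shows "(b - a)\<^sup>2 * pint a b (pderiv L * pderiv L) = 2 * real n * (real n + 1) * (2 * real n + 1) * pint a b (L * L)"
proof -
  define w where "w = [:- a * b, a + b, - 1:]"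
  define s where "s = [:- (a + b), 2:]"
  let ?n = "real n"
  have L: "degree L = n" "L \<noteq> 0" "\<And>q. q = 0 \<or> degree q < n \<Longrightarrow> pint a b (L * q) = 0"
    using assms(2) by (auto simp: legendre_def)
  define S where "S = (poly L a)\<^sup>2 + (poly L b)\<^sup>2"
  have eval: "poly (pderiv (w * pderiv L)) x = (a + b - 2 * x) * poly (pderiv L) x + (x - a) * (b - x) * poly (pderiv (pderiv L)) x" for x
  proof -
    have "pderiv w = [:a + b, -2:]" by (simp add: w_def pderiv_pCons)
    moreover have "poly w x = (x - a) * (b - x)" by (simp add: w_def algebra_simps)
    ultimately show ?thesis by (simp only: pderiv_mult poly_add poly_mult) (simp add: algebra_simps)
  qed
  have "(a + b - 2 * x) * poly (pderiv L) x + (x - a) * (b - x) * poly (pderiv (pderiv L)) x = - (?n * (?n + 1)) * poly L x" for x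
    using eval[of x] unfolding w_def legendre_ode[OF assms] by (simp add: algebra_simps)
  \<comment> \<open>At the endpoints the coefficient of L'' vanishes, so the equation expresses L'
    through L there.\<close>
  from this[of a] this[of b]
  have ends: "(b - a) * poly (pderiv L) a = - (?n * (?n + 1)) * poly L a"
     "(b - a) * poly (pderiv L) b = ?n * (?n + 1) * poly L b"
    by (simp_all add: algebra_simps)
  \<comment> \<open>L is orthogonal to L'', so only boundary terms remain after integrating by
    parts.\<close>
  have "pderiv (pderiv L) = 0 \<or> degree (pderiv (pderiv L)) < n"
    using L(1) by (cases "n \<le> 1") (auto simp: degree_pderiv pderiv_eq_0_iff)
  then have "pint a b (pderiv L * pderiv L) = poly L b * poly (pderiv L) b - poly L a * poly (pderiv L) a"
    using pint_by_parts[OF assms(1), of L "pderiv L"] L(3) by simp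
  then have "(b - a) * pint a b (pderiv L * pderiv L) = poly L b * ((b - a) * poly (pderiv L) b) - poly L a * ((b - a) * poly (pderiv L) a)"
    by algebra
  then have E: "(b - a) * pint a b (pderiv L * pderiv L) = ?n * (?n + 1) * S"
    unfolding ends by (simp add: S_def algebra_simps power2_eq_square)
  \<comment> \<open>The leading coefficient of s L' is 2 n times that of L, so r has lower degree
    and integrates to zero against L.\<close>
  define r where "r = s * pderiv L - smult (2 * ?n) L"
  have "r = 0 \<or> degree r < n"
  proof (rule degree_less_if_coeff_0)
    have "degree (s * pderiv L) \<le> n"
    proof (cases "n = 0")
      case True
      then have "pderiv L = 0" using L(1) by (simp add: pderiv_eq_0_iff)
      then show ?thesis by simp
    next
      case False
      have "degree (s * pderiv L) \<le> 1 + degree (pderiv L)"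
        using degree_mult_le[of s "pderiv L"] by (simp add: s_def)
      then show ?thesis using False L(1) by (simp add: degree_pderiv)
    qed
    then show "degree r \<le> n" unfolding r_def by (intro degree_diff_le) (auto simp: L(1))
    show "coeff r n = 0"
      using coeff_eq_0[of L "Suc n"]
      by (cases n) (simp_all add: r_def s_def coeff_pderiv coeff_pCons L(1) algebra_simps)
  qed
  then have "pint a b (L * (s * pderiv L)) = 2 * ?n * pint a b (L * L)"
    using L(3)[of r] by (simp add: r_def right_diff_distrib pint_linear)
  moreover have "pint a b (pderiv (s * L * L)) = (b - a) * S"
    using pint_pderiv[OF assms(1), of "s * L * L"]
    by (simp add: s_def S_def power2_eq_square algebra_simps)
  moreover have "pderiv (s * L * L) = smult 2 (L * L) + smult 2 (L * (s * pderiv L))"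
  proof -
    have "pderiv s = [:2:]" by (simp add: s_def pderiv_pCons)
    then have "pderiv (s * L * L) = smult 2 (L * L) + (L * (s * pderiv L) + L * (s * pderiv L))"
      by (simp add: pderiv_mult algebra_simps)
    also have "L * (s * pderiv L) + L * (s * pderiv L) = smult 2 (L * (s * pderiv L))"
      by (metis smult_add_left smult_1_left one_add_one)
    finally show ?thesis .
  qed
  ultimately have N: "(b - a) * S = (4 * ?n + 2) * pint a b (L * L)"
    by (simp add: pint_linear algebra_simps)
  have "(b - a)\<^sup>2 * pint a b (pderiv L * pderiv L) = (b - a) * (?n * (?n + 1) * S)"
    by (simp add: power2_eq_square E[symmetric])
  also have "\<dots> = ?n * (?n + 1) * ((b - a) * S)" by simp
  finally show ?thesis unfolding N by (simp add: algebra_simps)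
qed

text \<open>With X = ||x||^2, Y = ||y||^2 and Z = (x,y), the third hypothesis says ||t x - s y||^2
  >= 0, which yields ||x + y||^2 <= (s + t) (||x||^2 / s + ||y||^2 / t): Cauchy-Schwarz with
  weights, one summand at a time.\<close>

lemma weighted_square_bound:
  fixes X Y Z :: real
  assumes "0 < s" "0 < t" "0 \<le> t\<^sup>2 * X - 2 * s * t * Z + s\<^sup>2 * Y"
    "X \<le> s * M" "Y \<le> t * N"
  shows "X + 2 * Z + Y \<le> (s + t) * (M + N)"
proof -
  have "s * t * (X + 2 * Z + Y) \<le> (s + t) * (t * X + s * Y)"
    using assms(3) by (simp add: power2_eq_square algebra_simps)
  also have "\<dots> \<le> (s + t) * (t * (s * M) + s * (t * N))"
    using assms by (intro mult_left_mono add_mono) auto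
  also have "\<dots> = s * t * ((s + t) * (M + N))" by (simp add: algebra_simps)
  finally show ?thesis using assms(1,2) by simp
qed

text \<open>This is the square of \<open>d_coeff n\<close>, so that roots are taken only at the very
  end.\<close>

definition markov_const :: "nat \<Rightarrow> real" where
  "markov_const n = real (n * (n + 1) * (n + 2) * (n + 3)) / 2"

lemma markov_const_eq: "markov_const n = real n * (real n + 1) * (real n + 2) * (real n + 3) / 2"
  unfolding markov_const_def by (simp only: of_nat_mult of_nat_add of_nat_1 of_nat_numeral)

lemma markov_const_nonneg: "0 \<le> markov_const n"
  by (simp add: markov_const_def)

lemma markov_const_step:
  assumes "2 \<le> n"
  shows "2 * real n * (real n + 1) * (2 * real n + 1) + markov_const (n - 2) = markov_const n"
proof -
  define x where "x = real n"
  have "2 * x * (x + 1) * (2 * x + 1) + (x - 2) * (x - 2 + 1) * (x - 2 + 2) * (x - 2 + 3) / 2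
      = x * (x + 1) * (x + 2) * (x + 3) / 2"
    by (simp add: field_simps)
  moreover have "real (n - 2) = x - 2" using assms by (simp add: x_def)
  ultimately show ?thesis by (simp add: markov_const_eq x_def)
qed

lemma markov_const_mono: "m \<le> n \<Longrightarrow> markov_const m \<le> markov_const n"
  unfolding markov_const_eq by (intro divide_right_mono mult_mono) auto

lemma markov_const_ge: "2 * real n * (real n + 1) * (2 * real n + 1) \<le> markov_const n"
proof -
  consider "n = 0" | "n = 1" | "2 \<le> n" by linarith
  then show ?thesis
  proof cases
    case 3
    then show ?thesis using markov_const_step[of n] markov_const_nonneg[of "n - 2"] by linarith
  qed (simp_all add: markov_const_def)
qed

text \<open>Split off the top Legendre component of \<open>p\<close>. The remainder \<open>r\<close>
  has the same parity, so its degree drops by two and the induction hypothesis for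
  \<open>n - 2\<close> applies. The two parts are combined with weights \<open>s\<close> and
  \<open>markov_const (n - 2)\<close>, whose sum is \<open>markov_const n\<close>.\<close>

lemma markov_parity:
  assumes "a < b" "degree p \<le> n" "reflect a b p = smult ((- 1) ^ n) p"
  shows "(b - a)\<^sup>2 * pint a b (pderiv p * pderiv p) \<le> markov_const n * pint a b (p * p)"
  using assms(2,3)
proof (induction n arbitrary: p rule: less_induct)
  case (less n)
  obtain L where leg: "legendre a b n L" using legendre_exists by blast
  then have L: "degree L = n" "L \<noteq> 0" "\<And>q. degree q < n \<Longrightarrow> pint a b (L * q) = 0"
    by (auto simp: legendre_def)
  define c where "c = coeff p n / coeff L n"
  define r where "r = p - smult c L"
  have p: "p = smult c L + r" by (simp add: r_def)
  have "coeff L n \<noteq> 0" using L(1,2) by auto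
  have r: "r = 0 \<or> degree r < n"
  proof (rule degree_less_if_coeff_0)
    show "degree r \<le> n" unfolding r_def using L(1) less.prems by (intro degree_diff_le) auto
    show "coeff r n = 0" using \<open>coeff L n \<noteq> 0\<close> by (simp add: r_def c_def)
  qed
  then have Lr: "pint a b (L * r) = 0" using L(3) by auto
  define s where "s = 2 * real n * (real n + 1) * (2 * real n + 1)"
  define N where "N = pint a b (L * L)"
  have N: "(b - a)\<^sup>2 * pint a b (pderiv L * pderiv L) = s * N"
    using legendre_pderiv_norm[OF assms(1) leg] by (simp add: s_def N_def)
  have "N \<ge> 0" by (simp add: N_def pint_square_nonneg)
  have pp: "pint a b (p * p) = c\<^sup>2 * N + pint a b (r * r)"
    using Lr pint_square_lincomb[of a b c L 1 r] by (simp add: p N_def)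
  have dp: "pint a b (pderiv p * pderiv p) =
      c\<^sup>2 * pint a b (pderiv L * pderiv L) + 2 * (c * pint a b (pderiv L * pderiv r)) + pint a b (pderiv r * pderiv r)"
    using pint_square_lincomb[of a b c "pderiv L" 1 "pderiv r"] by (simp add: p pderiv_add pderiv_smult)
  show ?case
  \<comment> \<open>The weighted inequality needs positive weights, but
    \<open>markov_const (n - 2)\<close> is zero for n <= 2. For such n the remainder is constant, so
    this split removes the exception.\<close>
  proof (cases "pderiv r = 0")
    case True
    then have "(b - a)\<^sup>2 * pint a b (pderiv p * pderiv p) = c\<^sup>2 * (s * N)"
      by (simp add: dp N[symmetric])
    also have "\<dots> = s * (c\<^sup>2 * N)" by simp
    also have "\<dots> \<le> markov_const n * (c\<^sup>2 * N + pint a b (r * r))"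
      using markov_const_ge[of n] \<open>N \<ge> 0\<close> pint_square_nonneg[of a b r]
      by (intro mult_mono) (auto simp: s_def markov_const_def)
    finally show ?thesis by (simp add: pp)
  next
    case False
    then have "degree r \<noteq> 0" "r \<noteq> 0" by (auto simp: pderiv_eq_0_iff)
    have refl_r: "reflect a b r = smult ((- 1) ^ n) r"
      using less.prems(2) legendre_reflect[OF assms(1) leg]
      by (simp add: r_def pcompose_diff pcompose_smult smult_diff_right mult.commute)
    \<comment> \<open>Degree n - 1 would have the wrong parity.\<close>
    have "degree r \<noteq> n - 1"
      using parity_degree[OF refl_r \<open>r \<noteq> 0\<close>] \<open>degree r \<noteq> 0\<close> by (cases n) auto
    then have "degree r \<le> n - 2" "3 \<le> n" using r \<open>r \<noteq> 0\<close> \<open>degree r \<noteq> 0\<close> by auto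
    define t where "t = markov_const (n - 2)"
    have "t > 0" using \<open>3 \<le> n\<close>
      unfolding t_def markov_const_eq by (intro divide_pos_pos mult_pos_pos add_pos_pos) auto
    have "s > 0" using \<open>3 \<le> n\<close> by (simp add: s_def)
    have "reflect a b r = smult ((- 1) ^ (n - 2)) r"
    proof -
      have "n = n - 2 + 2" using \<open>3 \<le> n\<close> by simp
      then have "(- 1 :: real) ^ n = (- 1) ^ (n - 2) * (- 1)\<^sup>2" by (metis power_add)
      then show ?thesis using refl_r by simp
    qed
    then have IH: "(b - a)\<^sup>2 * pint a b (pderiv r * pderiv r) \<le> t * pint a b (r * r)"
      unfolding t_def using \<open>3 \<le> n\<close> \<open>degree r \<le> n - 2\<close> by (intro less.IH) auto
    let ?h = "(b - a)\<^sup>2"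
    let ?y = "smult (t * c) (pderiv L) + smult (- s) (pderiv r)"
    have "0 \<le> pint a b (?y * ?y)"
      by (rule pint_square_nonneg)
    also have "\<dots> = t\<^sup>2 * (c\<^sup>2 * pint a b (pderiv L * pderiv L)) - 2 * s * t * (c * pint a b (pderiv L * pderiv r)) + s\<^sup>2 * pint a b (pderiv r * pderiv r)"
      unfolding pint_square_lincomb by (simp add: power_mult_distrib)
    finally have "0 \<le> ?h * \<dots>" by simp
    then have "0 \<le> t\<^sup>2 * (c\<^sup>2 * (?h * pint a b (pderiv L * pderiv L))) - 2 * s * t * (?h * (c * pint a b (pderiv L * pderiv r))) + s\<^sup>2 * (?h * pint a b (pderiv r * pderiv r))"
      by (simp add: algebra_simps)
    from weighted_square_bound[OF \<open>s > 0\<close> \<open>t > 0\<close> this _ IH, of "c\<^sup>2 * N"]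
    have "c\<^sup>2 * (?h * pint a b (pderiv L * pderiv L)) + 2 * (?h * (c * pint a b (pderiv L * pderiv r))) + ?h * pint a b (pderiv r * pderiv r)
       \<le> (s + t) * (c\<^sup>2 * N + pint a b (r * r))"
      by (simp add: N)
    moreover have "s + t = markov_const n"
      unfolding s_def t_def using \<open>3 \<le> n\<close> by (intro markov_const_step) simp
    ultimately show ?thesis by (simp add: pp dp algebra_simps)
  qed
qed

lemma markov_L2:
  assumes "a < b" "degree p \<le> n"
  shows "(b - a)\<^sup>2 * pint a b (pderiv p * pderiv p) \<le> markov_const n * pint a b (p * p)"
proof -
  \<comment> \<open>The part \<open>s\<close> gets the parity of n and \<open>t\<close> the opposite
    one. A nonzero \<open>t\<close> therefore has degree less than n and satisfies the bound for n -
    1.\<close>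
  define \<epsilon> where "\<epsilon> = (- 1 :: real) ^ n"
  have \<epsilon>: "\<epsilon> * \<epsilon> = 1" by (simp add: \<epsilon>_def flip: power_mult_distrib)
  define s where "s = smult (1/2) (p + smult \<epsilon> (reflect a b p))"
  define t where "t = smult (1/2) (p - smult \<epsilon> (reflect a b p))"
  have p: "p = s + t"
    by (simp add: poly_eq_iff s_def t_def field_simps)
  have s: "reflect a b s = smult \<epsilon> s"
    by (simp add: s_def pcompose_smult pcompose_add reflect_reflect smult_add_right \<epsilon> add.commute mult.commute)
  have t: "reflect a b t = smult (- \<epsilon>) t"
    by (simp add: t_def pcompose_smult pcompose_diff reflect_reflect smult_diff_right \<epsilon> mult.commute)
  have deg: "degree s \<le> n" "degree t \<le> n"
    using assms(2) by (auto simp: s_def t_def intro!: degree_add_le degree_diff_le)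
  \<comment> \<open>Used for \<open>s\<close>, \<open>t\<close> and again for their derivatives,
    since differentiation flips both parities.\<close>
  have orth: "pint a b (f * g) = 0" if "reflect a b f = smult \<delta> f" "reflect a b g = smult (- \<delta>) g" "\<delta> * \<delta> = 1" for f g \<delta>
  proof -
    have "pint a b (f * g) = pint a b (reflect a b f * reflect a b g)"
      using pint_reflect[OF assms(1), of "f * g"] by (simp add: pcompose_mult)
    also have "\<dots> = - pint a b (f * g)" using that by (simp add: pint_linear)
    finally show ?thesis by simp
  qed
  have "pint a b (s * t) = 0" by (rule orth[OF s t \<epsilon>])
  then have pp: "pint a b (p * p) = pint a b (s * s) + pint a b (t * t)"
    using pint_square_lincomb[of a b 1 s 1 t] by (simp add: p)
  have "reflect a b (pderiv s) = smult (- \<epsilon>) (pderiv s)" "reflect a b (pderiv t) = smult (- (- \<epsilon>)) (pderiv t)"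
    using arg_cong[OF s, of pderiv] arg_cong[OF t, of pderiv]
    by (simp_all add: pderiv_reflect pderiv_smult pderiv_minus minus_equation_iff)
  then have "pint a b (pderiv s * pderiv t) = 0" by (rule orth) (simp add: \<epsilon>)
  then have dp: "pint a b (pderiv p * pderiv p) = pint a b (pderiv s * pderiv s) + pint a b (pderiv t * pderiv t)"
    using pint_square_lincomb[of a b 1 "pderiv s" 1 "pderiv t"] by (simp add: p pderiv_add)
  have "(b - a)\<^sup>2 * pint a b (pderiv s * pderiv s) \<le> markov_const n * pint a b (s * s)"
    using deg(1) s by (intro markov_parity assms(1)) (auto simp: \<epsilon>_def)
  moreover have "(b - a)\<^sup>2 * pint a b (pderiv t * pderiv t) \<le> markov_const n * pint a b (t * t)"
  proof (cases "t = 0")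
    case False
    have "degree t < n"
      using t False deg(2) by (intro parity_degree_less[where a = a and b = b]) (auto simp: \<epsilon>_def)
    then obtain m where m: "n = Suc m" "degree t \<le> m" by (cases n) auto
    then have "(b - a)\<^sup>2 * pint a b (pderiv t * pderiv t) \<le> markov_const m * pint a b (t * t)"
      using t by (intro markov_parity assms(1)) (auto simp: \<epsilon>_def)
    also have "\<dots> \<le> markov_const n * pint a b (t * t)"
      using m by (intro mult_right_mono markov_const_mono pint_square_nonneg) simp
    finally show ?thesis .
  qed simp
  ultimately show ?thesis by (simp add: pp dp algebra_simps)
qed

section \<open>Test functions and weak derivatives\<close>

text \<open>The polynomial factor in 1/y makes the family closed under differentiation, as p(1/y)
  exp(-1/y) has derivative r(1/y) exp(-1/y) with r(s) = s^2 (p(s) - p'(s)).\<close>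

definition bump_part :: "real poly \<Rightarrow> real \<Rightarrow> real" where
  "bump_part p y = (if 0 < y then poly p (1 / y) * exp (- (1 / y)) else 0)"

lemma bump_part_smult: "bump_part (smult k p) y = k * bump_part p y"
  by (simp add: bump_part_def)

text \<open>With s = 1/y this is the statement that exp(-s) beats every polynomial; left of zero the
  function vanishes.\<close>

lemma bump_part_tendsto_0: "(bump_part p \<longlongrightarrow> 0) (at 0)"
  unfolding filterlim_at_split
proof
  have "((\<lambda>s. \<Sum>i\<le>degree p. coeff p i * (s ^ i / exp s)) \<longlongrightarrow> (\<Sum>i\<le>degree p. coeff p i * 0)) at_top"
    by (intro tendsto_sum tendsto_mult_left tendsto_power_div_exp_0)
  then have lim: "((\<lambda>s. poly p s * exp (- s)) \<longlongrightarrow> 0) at_top"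
    by (simp add: poly_altdef sum_distrib_right exp_minus divide_inverse mult.assoc)
  have "((\<lambda>y. poly p (inverse y) * exp (- inverse y)) \<longlongrightarrow> 0) (at_right 0)"
    using filterlim_compose[OF lim filterlim_inverse_at_top_right] .
  then show "(bump_part p \<longlongrightarrow> 0) (at_right 0)"
  proof (rule Lim_transform_eventually)
    show "\<forall>\<^sub>F y in at_right 0. poly p (inverse y) * exp (- inverse y) = bump_part p y"
      by (auto simp: bump_part_def eventually_at_filter inverse_eq_divide)
  qed
  show "(bump_part p \<longlongrightarrow> 0) (at_left 0)"
    by (rule Lim_transform_eventually[OF tendsto_const])
      (auto simp: bump_part_def eventually_at_filter)
qed

lemma bump_part_deriv:
  "(bump_part p has_real_derivative bump_part ([:0, 0, 1:] * (p - pderiv p)) y) (at y)"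
proof -
  consider "0 < y" | "y < 0" | "y = 0" by linarith
  then show ?thesis
  proof cases
    case 1
    have "((\<lambda>y. poly p (1 / y) * exp (- (1 / y))) has_real_derivative
        bump_part ([:0, 0, 1:] * (p - pderiv p)) y) (at y)"
      using 1 by (auto intro!: derivative_eq_intros DERIV_chain2[OF poly_DERIV]
          simp: bump_part_def field_simps power2_eq_square)
    then show ?thesis
      by (rule has_field_derivative_transform_within_open[of _ _ _ "{0<..}"]) (use 1 in \<open>auto simp: bump_part_def\<close>)
  next
    case 2
    have "((\<lambda>y. 0) has_real_derivative bump_part ([:0, 0, 1:] * (p - pderiv p)) y) (at y)"
      using 2 by (simp add: bump_part_def)
    then show ?thesis
      by (rule has_field_derivative_transform_within_open[of _ _ _ "{..<0}"]) (use 2 in \<open>auto simp: bump_part_def\<close>)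
  next
    case 3
    \<comment> \<open>Dividing by h multiplies the polynomial in 1/h by its variable, so the
      difference quotient is again a bump part, that of \<open>pCons 0 p\<close>.\<close>
    have "((\<lambda>h. (bump_part p (0 + h) - bump_part p 0) / h) \<longlongrightarrow> 0) (at 0)"
      by (rule Lim_transform_eventually[OF bump_part_tendsto_0[of "pCons 0 p"]])
        (auto simp: bump_part_def eventually_at_filter)
    then show ?thesis using 3 by (simp add: DERIV_def bump_part_def)
  qed
qed

text \<open>This class of functions is closed under differentiation, hence all its members are smooth.\<close>

inductive bump_algebra :: "(real \<Rightarrow> real) \<Rightarrow> bool" where
  base: "bump_algebra (\<lambda>x. bump_part p (k * x + c))"
| add: "bump_algebra f \<Longrightarrow> bump_algebra g \<Longrightarrow> bump_algebra (\<lambda>x. f x + g x)"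
| mult: "bump_algebra f \<Longrightarrow> bump_algebra g \<Longrightarrow> bump_algebra (\<lambda>x. f x * g x)"

lemma bump_algebra_deriv:
  "bump_algebra f \<Longrightarrow> \<exists>f'. bump_algebra f' \<and> (\<forall>x. (f has_real_derivative f' x) (at x))"
proof (induction rule: bump_algebra.induct)
  case (base p k c)
  let ?p = "smult k ([:0, 0, 1:] * (p - pderiv p))"
  have "((\<lambda>x. bump_part p (k * x + c)) has_real_derivative bump_part ?p (k * x + c)) (at x)" for x
  proof -
    have "((\<lambda>x. k * x + c) has_real_derivative k) (at x)" by (auto intro!: derivative_eq_intros)
    from DERIV_chain2[OF bump_part_deriv this] show ?thesis
      unfolding bump_part_smult by (simp only: mult.commute)
  qed
  then show ?case using bump_algebra.base by (intro exI[of _ "\<lambda>x. bump_part ?p (k * x + c)"]) blast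
next
  case (add f g)
  then obtain f' g' where "bump_algebra f'" "\<forall>x. (f has_real_derivative f' x) (at x)"
    "bump_algebra g'" "\<forall>x. (g has_real_derivative g' x) (at x)" by blast
  then show ?case
    by (intro exI[of _ "\<lambda>x. f' x + g' x"] conjI allI bump_algebra.add DERIV_add) auto
next
  case (mult f g)
  then obtain f' g' where "bump_algebra f'" "\<forall>x. (f has_real_derivative f' x) (at x)"
    "bump_algebra g'" "\<forall>x. (g has_real_derivative g' x) (at x)" by blast
  then show ?case using mult
    by (intro exI[of _ "\<lambda>x. f' x * g x + g' x * f x"] conjI allI bump_algebra.add bump_algebra.mult DERIV_mult) auto
qed

lemma bump_algebra_smooth:
  assumes "bump_algebra f"
  shows "(deriv ^^ n) f differentiable (at x)"
proof -
  have "bump_algebra ((deriv ^^ n) f)"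
  proof (induction n)
    case (Suc n)
    then obtain f' where f': "bump_algebra f'" "\<And>x. ((deriv ^^ n) f has_real_derivative f' x) (at x)"
      using bump_algebra_deriv by blast
    then have "deriv ((deriv ^^ n) f) = f'" by (auto intro: DERIV_imp_deriv)
    then show ?case using f' by simp
  qed (simp add: assms)
  then show ?thesis
    using bump_algebra_deriv real_differentiable_def by blast
qed

text \<open>Test functions supported in [c,d], bounded by 1 and tending pointwise to the indicator
  of (c,d): for fixed y > 0, exp(-1 / ((n + 1) y)) tends to 1.\<close>

definition cutoff :: "real \<Rightarrow> real \<Rightarrow> nat \<Rightarrow> real \<Rightarrow> real" where
  "cutoff c d n x = bump_part 1 (real (Suc n) * (x - c)) * bump_part 1 (real (Suc n) * (d - x))"

lemma cutoff_test_fun: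
  assumes "a < c" "d < b"
  shows "test_fun a b (cutoff c d n)"
proof -
  let ?k = "real (Suc n)"
  have "bump_algebra (\<lambda>x. bump_part 1 (?k * x + - (?k * c)) * bump_part 1 (- ?k * x + ?k * d))"
    by (intro bump_algebra.mult bump_algebra.base)
  also have "(\<lambda>x. bump_part 1 (?k * x + - (?k * c)) * bump_part 1 (- ?k * x + ?k * d)) = cutoff c d n"
  proof
    fix x
    have "?k * x + - (?k * c) = ?k * (x - c)" "- ?k * x + ?k * d = ?k * (d - x)"
      by (simp_all add: algebra_simps)
    then show "bump_part 1 (?k * x + - (?k * c)) * bump_part 1 (- ?k * x + ?k * d) = cutoff c d n x"
      by (simp only: cutoff_def)
  qed
  finally have alg: "bump_algebra (cutoff c d n)" .
  moreover have "cutoff c d n x = 0" if "x \<notin> {c..d}" for x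
    using that by (auto simp: cutoff_def bump_part_def zero_less_mult_iff)
  ultimately show ?thesis unfolding test_fun_def using assms bump_algebra_smooth[OF alg] by blast
qed

lemma cutoff_le_1: "\<bar>cutoff c d n x\<bar> \<le> 1"
proof -
  have "\<bar>bump_part 1 y\<bar> \<le> 1" for y by (simp add: bump_part_def)
  then show ?thesis unfolding cutoff_def abs_mult by (intro mult_le_one) auto
qed

lemma cutoff_tendsto: "(\<lambda>n. cutoff c d n x) \<longlonglongrightarrow> indicator {c<..<d} x"
proof (cases "x \<in> {c<..<d}")
  case True
  have lim: "(\<lambda>n. bump_part 1 (real (Suc n) * y)) \<longlonglongrightarrow> 1" if "0 < y" for y
  proof -
    have "(\<lambda>n. exp (- (inverse (real (Suc n)) * (1 / y)))) \<longlonglongrightarrow> exp (- (0 * (1 / y)))"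
      by (intro tendsto_intros LIMSEQ_inverse_real_of_nat)
    then show ?thesis using that by (simp add: bump_part_def inverse_eq_divide zero_less_mult_iff del: of_nat_Suc)
  qed
  have "(\<lambda>n. cutoff c d n x) \<longlonglongrightarrow> 1 * 1"
    unfolding cutoff_def using True by (intro tendsto_mult lim) auto
  then show ?thesis using True by simp
next
  case False
  then have "cutoff c d n x = 0" for n
    by (auto simp: cutoff_def bump_part_def zero_less_mult_iff not_less)
  then show ?thesis using False by simp
qed

section \<open>Test functions and the fundamental lemma of the calculus of variations\<close>

lemma test_fun_differentiable: "test_fun a b \<phi> \<Longrightarrow> (deriv ^^ n) \<phi> differentiable (at x)"
  by (simp add: test_fun_def)

lemma test_fun_DERIV: "test_fun a b \<phi> \<Longrightarrow> (\<phi> has_real_derivative deriv \<phi> x) (at x)"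
  using test_fun_differentiable[of a b \<phi> 0 x] by (simp add: DERIV_deriv_iff_real_differentiable)

lemma test_fun_continuous: "test_fun a b \<phi> \<Longrightarrow> continuous_on S \<phi>"
  by (intro continuous_at_imp_continuous_on ballI DERIV_isCont[OF test_fun_DERIV])

lemma test_fun_support:
  assumes "test_fun a b \<phi>"
  obtains c d where "a < c" "d < b" "\<And>x. x \<notin> {c..d} \<Longrightarrow> \<phi> x = 0"
proof -
  from assms have "\<exists>c d. a < c \<and> d < b \<and> (\<forall>x. x \<notin> {c..d} \<longrightarrow> \<phi> x = 0)"
    unfolding test_fun_def by (rule conjunct2)
  then show ?thesis using that by blast
qed

lemma test_fun_deriv:
  assumes "test_fun a b \<phi>"
  shows "test_fun a b (deriv \<phi>)"
proof -
  obtain c d where cd: "a < c" "d < b" "\<And>x. x \<notin> {c..d} \<Longrightarrow> \<phi> x = 0"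
    using test_fun_support[OF assms] by blast
  have "deriv \<phi> x = 0" if "x \<notin> {c..d}" for x
  proof -
    have "(\<phi> has_real_derivative 0) (at x)"
      by (rule has_field_derivative_transform_within_open[of "\<lambda>x. 0" _ _ "- {c..d}"])
        (use that cd(3) in \<open>auto intro: open_Compl\<close>)
    then show ?thesis by (rule DERIV_imp_deriv)
  qed
  moreover have "(deriv ^^ n) (deriv \<phi>) differentiable (at x)" for n x
    using test_fun_differentiable[OF assms, of "Suc n" x] by (simp only: funpow_Suc_right comp_def)
  ultimately show ?thesis unfolding test_fun_def using cd by blast
qed

lemma test_fun_funpow_deriv: "test_fun a b \<phi> \<Longrightarrow> test_fun a b ((deriv ^^ n) \<phi>)"
  by (induction n) (auto intro: test_fun_deriv)

text \<open>A test function is bounded and lives on a compact subinterval, where local integrability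
  of \<open>f\<close> suffices.\<close>

lemma loc_integrable_test_fun:
  assumes "loc_integrable a b f" "test_fun a b \<phi>"
  shows "integrable (leb a b) (\<lambda>x. f x * \<phi> x)"
proof -
  obtain c d where cd: "a < c" "d < b" "\<And>x. x \<notin> {c..d} \<Longrightarrow> \<phi> x = 0"
    using test_fun_support[OF assms(2)] by blast
  have f: "integrable (lebesgue_on {c..d}) f" using assms(1) cd by (simp add: loc_integrable_def)
  have cont: "continuous_on {c..d} \<phi>" by (rule test_fun_continuous[OF assms(2)])
  then have "bounded (\<phi> ` {c..d})" by (intro compact_imp_bounded compact_continuous_image) auto
  then obtain B where "\<forall>y\<in>\<phi> ` {c..d}. norm y \<le> B" by (auto simp: bounded_iff)
  then have B: "\<bar>\<phi> x\<bar> \<le> B" if "x \<in> {c..d}" for x using that by auto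
  have "integrable (lebesgue_on {c..d}) (\<lambda>x. f x * \<phi> x)"
  proof (rule Bochner_Integration.integrable_bound)
    show "integrable (lebesgue_on {c..d}) (\<lambda>x. B * f x)" using f by simp
    show "(\<lambda>x. f x * \<phi> x) \<in> borel_measurable (lebesgue_on {c..d})"
      using f continuous_imp_integrable_real[OF cont]
      by (intro borel_measurable_times) (auto dest: borel_measurable_integrable)
    show "AE x in lebesgue_on {c..d}. norm (f x * \<phi> x) \<le> norm (B * f x)"
    proof (rule AE_I2)
      fix x assume "x \<in> space (lebesgue_on {c..d})"
      then have "\<bar>\<phi> x\<bar> \<le> B" using B by simp
      then have "\<bar>f x\<bar> * \<bar>\<phi> x\<bar> \<le> \<bar>f x\<bar> * \<bar>B\<bar>" by (intro mult_left_mono) auto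
      then show "norm (f x * \<phi> x) \<le> norm (B * f x)"
        by (simp only: real_norm_def abs_mult mult.commute)
    qed
  qed
  moreover have "(\<lambda>x. indicator {c..d} x * (f x * \<phi> x)) = (\<lambda>x. indicator {a<..<b} x * (f x * \<phi> x))"
    using cd by (auto simp: fun_eq_iff indicator_def)
  ultimately show ?thesis by (simp add: integrable_lebesgue_on_iff)
qed

text \<open>Test against \<open>cutoff c d n\<close> and let n grow; |h| restricted to [c,d] is the
  integrable majorant.\<close>

lemma interval_integral_zero:
  assumes "loc_integrable a b h" "\<And>\<phi>. test_fun a b \<phi> \<Longrightarrow> (LINT x|leb a b. h x * \<phi> x) = 0"
    "a < c" "d < b"
  shows "integral {c..d} h = 0"
proof -
  have h: "integrable (lebesgue_on {c..d}) h" using assms by (simp add: loc_integrable_def)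
  have sub: "{c..d} \<subseteq> {a<..<b}" using assms by auto
  have eq: "(\<lambda>x. indicator {a<..<b} x * (indicator {c..d} x * h x)) = (\<lambda>x. indicator {c..d} x * h x)"
    using sub by (auto simp: fun_eq_iff indicator_def)
  have hi: "integrable (leb a b) (\<lambda>x. indicator {c..d} x * h x)"
    using h by (simp add: integrable_lebesgue_on_iff eq)
  have lim: "(\<lambda>n. LINT x|leb a b. h x * cutoff c d n x) \<longlonglongrightarrow> (LINT x|leb a b. indicator {c<..<d} x * (indicator {c..d} x * h x))"
  proof (rule integral_dominated_convergence)
    show "(\<lambda>x. indicator {c<..<d} x * (indicator {c..d} x * h x)) \<in> borel_measurable (leb a b)"
      using assms(3,4)
      by (intro borel_measurable_times[OF borel_measurable_indicator borel_measurable_integrable[OF hi]])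
        (auto simp: sets_restrict_space_iff)
    show "(\<lambda>x. h x * cutoff c d n x) \<in> borel_measurable (leb a b)" for n
      by (intro borel_measurable_integrable loc_integrable_test_fun assms cutoff_test_fun)
    show "integrable (leb a b) (\<lambda>x. \<bar>indicator {c..d} x * h x\<bar>)" using hi by simp
    show "AE x in leb a b. (\<lambda>n. h x * cutoff c d n x) \<longlonglongrightarrow> indicator {c<..<d} x * (indicator {c..d} x * h x)"
    proof (rule AE_I2)
      fix x
      have eq: "indicator {c<..<d} x * (indicator {c..d} x * h x) = h x * indicator {c<..<d} x"
        by (auto simp: indicator_def)
      show "(\<lambda>n. h x * cutoff c d n x) \<longlonglongrightarrow> indicator {c<..<d} x * (indicator {c..d} x * h x)"
        unfolding eq by (intro tendsto_mult_left cutoff_tendsto)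
    qed
    show "AE x in leb a b. norm (h x * cutoff c d n x) \<le> \<bar>indicator {c..d} x * h x\<bar>" for n
    proof (rule AE_I2)
      fix x
      show "norm (h x * cutoff c d n x) \<le> \<bar>indicator {c..d} x * h x\<bar>"
      proof (cases "x \<in> {c..d}")
        case True
        then show ?thesis using cutoff_le_1[of c d n x] by (simp add: abs_mult mult_left_le)
      next
        case False
        then have "cutoff c d n x = 0"
          by (auto simp: cutoff_def bump_part_def zero_less_mult_iff)
        then show ?thesis by simp
      qed
    qed
  qed
  have zero: "(LINT x|leb a b. h x * cutoff c d n x) = 0" for n
    by (intro assms cutoff_test_fun)
  have "(LINT x|leb a b. indicator {c<..<d} x * (indicator {c..d} x * h x)) = 0"
    using lim unfolding zero LIMSEQ_const_iff by (rule sym)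
  moreover have "(\<lambda>x. indicator {a<..<b} x * (indicator {c<..<d} x * (indicator {c..d} x * h x))) = (\<lambda>x. indicator {c<..<d} x * h x)"
    using assms(3,4) by (auto simp: fun_eq_iff indicator_def)
  ultimately have "(LINT x|leb c d. h x) = 0"
    by (simp add: integral_lebesgue_on_eq)
  moreover have "integrable (leb c d) h" using h by (simp add: integrable_leb_iff_closed)
  ultimately show ?thesis
    using lebesgue_integral_eq_integral[of "{c<..<d}" h] unfolding integral_open_interval_real by simp
qed

text \<open>All integrals of \<open>h\<close> over compact subintervals vanish, so by Lebesgue
  differentiation \<open>h\<close> vanishes almost everywhere in each of them, and countably many
  exhaust (a,b).\<close>

lemma variational_zero:
  assumes "loc_integrable a b h" "\<And>\<phi>. test_fun a b \<phi> \<Longrightarrow> (LINT x|leb a b. h x * \<phi> x) = 0"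
  shows "AE x in leb a b. h x = 0"
proof -
  have sub: "AE x in lebesgue. x \<in> {c<..<d} \<longrightarrow> h x = 0" if cd: "a < c" "d < b" for c d
  proof -
    \<comment> \<open>The differentiation theorem asks for integrability over every box, hence the
      extension of \<open>h\<close> by zero.\<close>
    define g where "g x = (if x \<in> {c..d} then h x else 0)" for x
    have "integrable (lebesgue_on {c..d}) h" using assms(1) cd by (simp add: loc_integrable_def)
    then have "h integrable_on {c..d}" by (rule integrable_on_lebesgue_on) simp
    then have "g integrable_on UNIV" unfolding g_def integrable_restrict_UNIV .
    then have "g integrable_on cbox u v" for u v by (rule integrable_on_subcbox) auto
    from integrable_ccontinuous_explicit[OF this] obtain N where N: "negligible N"
      "\<And>x e. x \<notin> N \<Longrightarrow> 0 < e \<Longrightarrow> \<exists>\<delta>>0. \<forall>k. 0 < k \<and> k < \<delta> \<longrightarrow>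
          norm (integral (cbox x (x + k *\<^sub>R One)) g /\<^sub>R k ^ DIM(real) - g x) < e"
      by blast
    have "h x = 0" if x: "x \<in> {c<..<d}" "x \<notin> N" for x
    proof (rule ccontr)
      assume "h x \<noteq> 0"
      then obtain \<delta> where \<delta>: "\<delta> > 0" "\<And>k. 0 < k \<Longrightarrow> k < \<delta> \<Longrightarrow>
          norm (integral (cbox x (x + k *\<^sub>R One)) g /\<^sub>R k ^ DIM(real) - g x) < \<bar>h x\<bar>"
        using N(2)[OF x(2), of "\<bar>h x\<bar>"] by auto
      \<comment> \<open>Small enough that [x, x + k] stays in [c,d], where \<open>g\<close> is
        \<open>h\<close>.\<close>
      define k where "k = min (\<delta> / 2) (d - x)"
      have k: "0 < k" "k < \<delta>" "x + k \<le> d" using \<delta>(1) x(1) by (auto simp: k_def)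
      have "integral {x..x + k} g = integral {x..x + k} h"
        using k x(1) by (intro integral_cong) (auto simp: g_def)
      also have "\<dots> = 0" using k x(1) cd by (intro interval_integral_zero[OF assms]) auto
      finally show False using \<delta>(2)[OF k(1,2)] x(1) by (simp add: g_def)
    qed
    moreover have "AE x in lebesgue. x \<notin> N" using N(1) by (intro AE_not_in) (simp add: negligible_iff_null_sets)
    ultimately show ?thesis by (auto elim: eventually_mono)
  qed
  have "AE x in lebesgue. \<forall>n. x \<in> {a + inverse (real (Suc n))<..<b - inverse (real (Suc n))} \<longrightarrow> h x = 0"
    unfolding AE_all_countable by (intro allI sub) auto
  then have "AE x in lebesgue. x \<in> {a<..<b} \<longrightarrow> h x = 0"
  proof eventually_elim
    case (elim x)
    show ?case
    proof
      assume x: "x \<in> {a<..<b}"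
      then obtain n where "inverse (real (Suc n)) < min (x - a) (b - x)"
        using reals_Archimedean[of "min (x - a) (b - x)"] by auto
      then show "h x = 0" using elim[rule_format, of n] by auto
    qed
  qed
  then show ?thesis by (simp add: AE_restrict_space_iff)
qed

text \<open>This makes the \<open>SOME\<close> in \<open>weak_deriv\<close> harmless: inner products
  and norms do not depend on the chosen representative.\<close>

lemma has_weak_deriv_unique:
  assumes "has_weak_deriv a b n f g" "has_weak_deriv a b n f g'"
  shows "ae_eq a b g g'"
proof -
  have loc: "loc_integrable a b g" "loc_integrable a b g'" using assms by (auto simp: has_weak_deriv_def)
  have "AE x in leb a b. g x - g' x = 0"
  proof (rule variational_zero)
    show "loc_integrable a b (\<lambda>x. g x - g' x)" using loc by (auto simp: loc_integrable_def)
    fix \<phi> assume \<phi>: "test_fun a b \<phi>"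
    have "(- 1) ^ n * (LINT x|leb a b. g x * \<phi> x) = (- 1) ^ n * (LINT x|leb a b. g' x * \<phi> x)"
      using assms \<phi> by (simp add: has_weak_deriv_def)
    then show "(LINT x|leb a b. (g x - g' x) * \<phi> x) = 0"
      using loc_integrable_test_fun[OF loc(1) \<phi>] loc_integrable_test_fun[OF loc(2) \<phi>]
      by (simp add: left_diff_distrib)
  qed
  then show ?thesis by (simp add: ae_eq_def)
qed

lemma weak_deriv_works:
  assumes "has_weak_deriv a b n f g"
  shows "has_weak_deriv a b n f (weak_deriv a b n f)"
  unfolding weak_deriv_def using assms by (rule someI[of "has_weak_deriv a b n f"])

lemma weak_deriv_ae_eq: "has_weak_deriv a b n f g \<Longrightarrow> ae_eq a b g (weak_deriv a b n f)"
  by (rule has_weak_deriv_unique[OF _ weak_deriv_works])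

lemma has_weak_deriv_diff:
  assumes "has_weak_deriv a b n f g" "has_weak_deriv a b n f' g'"
  shows "has_weak_deriv a b n (\<lambda>x. f x - f' x) (\<lambda>x. g x - g' x)"
proof -
  have loc: "loc_integrable a b f" "loc_integrable a b f'" "loc_integrable a b g" "loc_integrable a b g'"
    using assms by (auto simp: has_weak_deriv_def)
  show ?thesis
    unfolding has_weak_deriv_def
  proof (intro conjI allI impI)
    show "loc_integrable a b (\<lambda>x. f x - f' x)" "loc_integrable a b (\<lambda>x. g x - g' x)"
      using loc by (auto simp: loc_integrable_def)
    fix \<phi> assume \<phi>: "test_fun a b \<phi>"
    show "(LINT x|leb a b. (f x - f' x) * (deriv ^^ n) \<phi> x) = (- 1) ^ n * (LINT x|leb a b. (g x - g' x) * \<phi> x)"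
      using assms \<phi> loc[THEN loc_integrable_test_fun, OF \<phi>]
        loc[THEN loc_integrable_test_fun, OF test_fun_funpow_deriv[OF \<phi>], of n]
      by (simp add: left_diff_distrib right_diff_distrib has_weak_deriv_def)
  qed
qed

text \<open>The n-th derivative of a test function is itself a test function, so it may be inserted
  into the identity for the first derivative.\<close>

lemma has_weak_deriv_Suc:
  assumes "has_weak_deriv a b 1 f g" "has_weak_deriv a b n g h"
  shows "has_weak_deriv a b (Suc n) f h"
proof -
  have "(LINT x|leb a b. f x * (deriv ^^ Suc n) \<phi> x) = (- 1) ^ Suc n * (LINT x|leb a b. h x * \<phi> x)"
    if "test_fun a b \<phi>" for \<phi>
    using assms test_fun_funpow_deriv[OF that, of n] that by (simp add: has_weak_deriv_def)
  then show ?thesis using assms by (simp only: has_weak_deriv_def) blast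
qed

text \<open>The same identity read backwards. It is needed to see that the first derivative of an
  H^(q+1) function lies in H^q.\<close>

lemma has_weak_deriv_Suc_imp:
  assumes "has_weak_deriv a b 1 f g" "has_weak_deriv a b (Suc n) f h"
  shows "has_weak_deriv a b n g h"
proof -
  have "(LINT x|leb a b. g x * (deriv ^^ n) \<phi> x) = (- 1) ^ n * (LINT x|leb a b. h x * \<phi> x)"
    if \<phi>: "test_fun a b \<phi>" for \<phi>
  proof -
    have "(LINT x|leb a b. f x * deriv ((deriv ^^ n) \<phi>) x) = - (LINT x|leb a b. g x * (deriv ^^ n) \<phi> x)"
      using assms(1) test_fun_funpow_deriv[OF \<phi>, of n] by (simp add: has_weak_deriv_def)
    moreover have "(LINT x|leb a b. f x * deriv ((deriv ^^ n) \<phi>) x) = - ((- 1) ^ n * (LINT x|leb a b. h x * \<phi> x))"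
      using assms(2) \<phi> by (simp add: has_weak_deriv_def)
    ultimately show ?thesis by simp
  qed
  then show ?thesis using assms by (simp only: has_weak_deriv_def) blast
qed

lemma L2_loc_integrable:
  assumes "f \<in> L2 a b"
  shows "loc_integrable a b f"
  unfolding loc_integrable_def
proof (intro allI impI)
  fix c d assume "a < c \<and> d < b"
  then have "{c..d} \<subseteq> {a<..<b}" by auto
  then show "integrable (lebesgue_on {c..d}) f"
    by (intro integrable_lebesgue_on_subset[OF L2_integrable[OF assms]]) auto
qed

lemma has_weak_deriv_0: "f \<in> L2 a b \<Longrightarrow> has_weak_deriv a b 0 f f"
  by (simp add: has_weak_deriv_def L2_loc_integrable)

lemma has_weak_deriv_ae_eq:
  assumes "has_weak_deriv a b n f g" "f' \<in> L2 a b" "g' \<in> L2 a b" "ae_eq a b f' f" "ae_eq a b g' g"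
  shows "has_weak_deriv a b n f' g'"
  unfolding has_weak_deriv_def
proof (intro conjI allI impI)
  show loc: "loc_integrable a b f'" "loc_integrable a b g'" using assms by (auto intro: L2_loc_integrable)
  fix \<phi> assume \<phi>: "test_fun a b \<phi>"
  have eq: "(LINT x|leb a b. k' x * \<psi> x) = (LINT x|leb a b. k x * \<psi> x)"
    if "loc_integrable a b k'" "ae_eq a b k' k" "test_fun a b \<psi>" for k k' \<psi>
  proof (rule integral_ae_eq)
    show "(\<lambda>x. k' x * \<psi> x) \<in> borel_measurable (leb a b)"
      using loc_integrable_test_fun[OF that(1,3)] by (rule borel_measurable_integrable)
    show "ae_eq a b (\<lambda>x. k' x * \<psi> x) (\<lambda>x. k x * \<psi> x)"
      using that(2) unfolding ae_eq_def by (auto elim: eventually_mono)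
  qed
  show "(LINT x|leb a b. f' x * (deriv ^^ n) \<phi> x) = (- 1) ^ n * (LINT x|leb a b. g' x * \<phi> x)"
    using assms(1) \<phi> eq[OF loc(1) assms(4) test_fun_funpow_deriv[OF \<phi>]] eq[OF loc(2) assms(5) \<phi>]
    by (simp add: has_weak_deriv_def)
qed

section \<open>The integration operator\<close>

lemma K_eq_closed: "K a f x = (LINT y|lebesgue. indicator {a..x} y * f y)"
  by (simp add: K_def integral_lebesgue_on_eq)

lemma L2_subinterval:
  assumes "f \<in> L2 a b" "a \<le> c" "d \<le> b"
  shows "f \<in> L2 c d"
proof -
  have sub: "{c<..<d} \<subseteq> {a<..<b}" using assms by auto
  have "f \<in> borel_measurable (leb a b)" "integrable (leb a b) (\<lambda>x. (f x)\<^sup>2)"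
    using assms(1) by (simp_all add: L2_def)
  from measurable_restrict_mono[OF this(1) sub] integrable_lebesgue_on_subset[OF this(2) sub] show ?thesis
    by (simp add: L2_def)
qed

lemma ae_eq_subinterval:
  assumes "ae_eq a b f g" "a \<le> c" "d \<le> b"
  shows "ae_eq c d f g"
proof -
  have "AE x in lebesgue. x \<in> {a<..<b} \<longrightarrow> f x = g x"
    using assms(1) by (simp add: ae_eq_def AE_restrict_space_iff)
  then have "AE x in lebesgue. x \<in> {c<..<d} \<longrightarrow> f x = g x"
    by eventually_elim (use assms(2,3) in auto)
  then show ?thesis by (simp add: ae_eq_def AE_restrict_space_iff)
qed

lemma K_eq_leb:
  assumes "f \<in> L2 a b" "x \<le> b"
  shows "K a f x = (LINT y|leb a x. f y)"
proof -
  have "f \<in> L2 a x" using assms L2_subinterval by auto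
  then have i: "integrable (leb a x) f" by (rule L2_integrable)
  then have "integrable (lebesgue_on {a..x}) f" by (simp add: integrable_leb_iff_closed)
  from lebesgue_integral_eq_integral[OF this] show ?thesis
    unfolding K_def integral_leb_eq_closed[OF i] by simp
qed

lemma K_continuous:
  assumes "f \<in> L2 a b"
  shows "continuous_on {a..b} (K a f)"
proof -
  have "integrable (lebesgue_on {a..b}) f"
    using L2_integrable[OF assms] by (simp add: integrable_leb_iff_closed)
  then show ?thesis unfolding K_def by (rule indefinite_integral_continuous_real)
qed

lemma K_L2: "f \<in> L2 a b \<Longrightarrow> K a f \<in> L2 a b"
  by (rule L2_continuous[OF K_continuous])

lemma K_ae_eq:
  assumes "f \<in> L2 a b" "ae_eq a b f g" "x \<le> b"
  shows "K a f x = K a g x"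
proof -
  have "ae_eq a x f g" "f \<in> L2 a x" "g \<in> L2 a b"
    using assms ae_eq_subinterval[of a b f g a x] L2_subinterval[of f a b a x] L2_ae_eq[of f a b g] by auto
  then show ?thesis
    using assms by (simp add: K_eq_leb integral_ae_eq[of f a x g] L2_measurable)
qed

lemma K_add:
  assumes "f \<in> L2 a b" "g \<in> L2 a b" "x \<le> b"
  shows "K a (\<lambda>x. f x + g x) x = K a f x + K a g x"
proof -
  have "integrable (leb a x) f" "integrable (leb a x) g"
    using assms L2_integrable L2_subinterval by auto
  then show ?thesis using assms by (simp add: K_eq_leb[where b = b] L2_add)
qed

lemma K_cmult: "K a (\<lambda>x. c * f x) x = c * K a f x"
  by (simp add: K_def)

lemma K_sum:
  assumes "finite B" "\<And>g. g \<in> B \<Longrightarrow> F g \<in> L2 a b" "x \<le> b"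
  shows "K a (\<lambda>x. \<Sum>g\<in>B. F g x) x = (\<Sum>g\<in>B. K a (F g) x)"
  using assms
proof (induction B rule: finite_induct)
  case empty
  then show ?case by (simp add: K_def)
next
  case (insert g B)
  then show ?case using K_add[of "F g" a b "\<lambda>x. \<Sum>g\<in>B. F g x" x] by (simp add: L2_sum)
qed

lemma K_poly:
  assumes "a < x"
  shows "K a (poly (pderiv p)) x = poly p x - poly p a"
  using pint_pderiv[OF assms, of p] by (simp add: K_eq_leb[where b = x] pint_def)

text \<open>The fundamental theorem on [y,M] for an M beyond the supports of the test function and
  its derivative.\<close>

lemma integral_indicator_atLeast_deriv:
  assumes "test_fun a b \<phi>"
  shows "(LINT x|lborel. indicator {y..} x * deriv \<phi> x) = - \<phi> y"
proof -
  obtain c d where cd: "a < c" "d < b" "\<And>x. x \<notin> {c..d} \<Longrightarrow> deriv \<phi> x = 0"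
    using test_fun_support[OF test_fun_deriv[OF assms]] by blast
  obtain c' d' where cd': "a < c'" "d' < b" "\<And>x. x \<notin> {c'..d'} \<Longrightarrow> \<phi> x = 0"
    using test_fun_support[OF assms] by blast
  define M where "M = max y (max d d') + 1"
  have M: "y < M" "d < M" "d' < M" by (auto simp: M_def)
  have "(LINT x|lborel. deriv \<phi> x * indicator {y..M} x) = \<phi> M - \<phi> y"
  proof (rule integral_FTC_Icc_real)
    show "y \<le> M" by (simp add: M_def)
    show "(\<phi> has_real_derivative deriv \<phi> x) (at x)" for x by (rule test_fun_DERIV[OF assms])
    show "isCont (deriv \<phi>) x" for x
      using test_fun_continuous[OF test_fun_deriv[OF assms], of UNIV] by (simp add: continuous_on_eq_continuous_at)
  qed
  moreover have "(\<lambda>x. indicator {y..} x * deriv \<phi> x) = (\<lambda>x. deriv \<phi> x * indicator {y..M} x)"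
    using cd(3) M by (fastforce simp: fun_eq_iff indicator_def)
  moreover have "\<phi> M = 0" by (rule cd'(3)) (use M in simp)
  ultimately show ?thesis by simp
qed

text \<open>Fubini on the half-plane y <= x: integrating g(y) deriv phi(x) over x first leaves -
  g(y) phi(y).\<close>

lemma integral_K_deriv:
  assumes g: "g \<in> L2 a b" and \<phi>: "test_fun a b \<phi>"
  shows "(LINT x|leb a b. K a g x * deriv \<phi> x) = - (LINT x|leb a b. g x * \<phi> x)"
proof -
  define \<psi> where "\<psi> = deriv \<phi>"
  have \<psi>: "test_fun a b \<psi>" unfolding \<psi>_def by (rule test_fun_deriv[OF \<phi>])
  obtain c d where cd: "a < c" "d < b" "\<And>x. x \<notin> {c..d} \<Longrightarrow> \<psi> x = 0"
    using test_fun_support[OF \<psi>] by blast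
  have \<psi>b [measurable]: "\<psi> \<in> borel_measurable borel"
    using test_fun_continuous[OF \<psi>] by (rule borel_measurable_continuous_onI)
  have \<psi>i: "integrable lborel \<psi>"
  proof -
    have "integrable lborel (\<lambda>x. indicator {c..d} x *\<^sub>R \<psi> x)"
      by (intro borel_integrable_compact test_fun_continuous[OF \<psi>]) auto
    moreover have "(\<lambda>x. indicator {c..d} x *\<^sub>R \<psi> x) = \<psi>" using cd by (auto simp: fun_eq_iff indicator_def)
    ultimately show ?thesis by simp
  qed
  define G0 where "G0 x = indicator {a<..<b} x * g x" for x
  have G0: "integrable lebesgue G0"
    using L2_integrable[OF g] by (simp add: integrable_lebesgue_on_iff G0_def[abs_def])
  \<comment> \<open>Fubini is applied on the product of Borel measures, but \<open>g\<close> is only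
    Lebesgue measurable; hence a Borel representative of its zero extension.\<close>
  obtain G where G [measurable]: "G \<in> borel_measurable lborel" and "AE x in lborel. G0 x = G x"
    using completion_ex_borel_measurable_real[OF borel_measurable_integrable[OF G0]] by blast
  then have ae: "AE x in lebesgue. G0 x = G x" by (intro AE_completion)
  have "integrable lebesgue G"
    by (rule integrable_cong_AE_imp[OF G0]) (use ae in \<open>auto intro: measurable_completion\<close>)
  then have Gi: "integrable lborel G" by (simp add: integrable_completion)
  have Kg: "K a g x = (LINT y|lborel. indicator {..x} y * G y)" if "x < b" for x
  proof -
    have "K a g x = (LINT y|lebesgue. indicator {..x} y * G y)"
      unfolding K_eq_closed
    proof (rule integral_cong_AE)
      have "integrable (lebesgue_on {a..x}) g"
        using that L2_integrable[OF L2_subinterval[OF g, of a x]] by (simp add: integrable_leb_iff_closed)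
      then show "(\<lambda>y. indicator {a..x} y * g y) \<in> borel_measurable lebesgue"
        by (auto simp: integrable_lebesgue_on_iff dest: borel_measurable_integrable)
      show "(\<lambda>y. indicator {..x} y * G y) \<in> borel_measurable lebesgue"
        by (intro measurable_completion) measurable
      show "AE y in lebesgue. indicator {a..x} y * g y = indicator {..x} y * G y"
        using ae AE_lebesgue_neq[of a]
        by eventually_elim (use that in \<open>auto simp: G0_def indicator_def split: if_splits\<close>)
    qed
    then show ?thesis by (simp add: integral_completion)
  qed
  define f where "f x y = indicator {..x} y * G y * \<psi> x" for x y :: real
  have "{z \<in> space (lborel \<Otimes>\<^sub>M lborel). snd z \<le> (fst z :: real)} \<in> sets (lborel \<Otimes>\<^sub>M lborel)"
    by measurable
  then have set: "{z::real \<times> real. snd z \<le> fst z} \<in> sets (lborel \<Otimes>\<^sub>M lborel)"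
    by (simp add: space_pair_measure)
  \<comment> \<open>In this form joint measurability reduces to that of the closed half-plane and
    the two one-variable factors.\<close>
  have f_alt: "case_prod f = (\<lambda>z. indicator {z. snd z \<le> fst z} z * G (snd z) * \<psi> (fst z))"
    by (auto simp: f_def fun_eq_iff indicator_def)
  have fm [measurable]: "case_prod f \<in> borel_measurable (lborel \<Otimes>\<^sub>M lborel)"
    unfolding f_alt using set by measurable
  have f_y: "integrable lborel (f x)" for x
  proof -
    have "integrable lborel (\<lambda>y. indicator {..x} y *\<^sub>R G y)"
      using Gi by (intro integrable_mult_indicator) auto
    then show ?thesis unfolding f_def[abs_def] by simp
  qed
  have "integrable (lborel \<Otimes>\<^sub>M lborel) (case_prod f)"
  proof (rule lborel_pair.Fubini_integrable)
    show "AE x in lborel. integrable lborel (\<lambda>y. case_prod f (x, y))" using f_y by simp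
    show "integrable lborel (\<lambda>x. LINT y|lborel. norm (case_prod f (x, y)))"
    proof (rule Bochner_Integration.integrable_bound)
      show "integrable lborel (\<lambda>x. (LINT y|lborel. \<bar>G y\<bar>) * \<psi> x)" using \<psi>i by simp
      show "(\<lambda>x. LINT y|lborel. norm (case_prod f (x, y))) \<in> borel_measurable lborel" by measurable
      have "(LINT y|lborel. \<bar>f x y\<bar>) \<le> (LINT y|lborel. \<bar>G y\<bar> * \<bar>\<psi> x\<bar>)" for x
      proof (rule integral_mono)
        show "integrable lborel (\<lambda>y. \<bar>f x y\<bar>)" by (rule integrable_abs[OF f_y])
        show "integrable lborel (\<lambda>y. \<bar>G y\<bar> * \<bar>\<psi> x\<bar>)" using Gi by simp
        show "\<bar>f x y\<bar> \<le> \<bar>G y\<bar> * \<bar>\<psi> x\<bar>" for y by (simp add: f_def abs_mult indicator_def)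
      qed
      then have "norm (LINT y|lborel. norm (case_prod f (x, y))) \<le> norm ((LINT y|lborel. \<bar>G y\<bar>) * \<psi> x)" for x
        by (simp add: abs_mult)
      then show "AE x in lborel. norm (LINT y|lborel. norm (case_prod f (x, y))) \<le> norm ((LINT y|lborel. \<bar>G y\<bar>) * \<psi> x)"
        by simp
    qed
  qed simp
  from lborel_pair.Fubini_integral[OF this]
  have fubini: "(LINT x|lborel. LINT y|lborel. f x y) = (LINT y|lborel. LINT x|lborel. f x y)" by simp
  have "(LINT x|leb a b. K a g x * \<psi> x) = (LINT x|lebesgue. indicator {a<..<b} x * (K a g x * \<psi> x))"
    by (simp add: integral_lebesgue_on_eq)
  also have "\<dots> = (LINT x|lebesgue. LINT y|lborel. f x y)"
  proof (rule Bochner_Integration.integral_cong)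
    fix x
    show "indicator {a<..<b} x * (K a g x * \<psi> x) = (LINT y|lborel. f x y)"
    \<comment> \<open>The formula \<open>Kg\<close> holds only for x < b; off the support of
      \<open>\<psi>\<close> both sides are zero.\<close>
    proof (cases "x \<in> {c..d}")
      case True
      then show ?thesis using cd by (simp add: Kg f_def)
    next
      case False
      then show ?thesis using cd by (simp add: f_def)
    qed
  qed simp
  also have "\<dots> = (LINT x|lborel. LINT y|lborel. f x y)"
    by (rule integral_completion) measurable
  also have "\<dots> = (LINT y|lborel. LINT x|lborel. f x y)" by (rule fubini)
  also have "\<dots> = (LINT y|lborel. - (G y * \<phi> y))"
  proof (rule Bochner_Integration.integral_cong)
    fix y
    have "(\<lambda>x. f x y) = (\<lambda>x. G y * (indicator {y..} x * deriv \<phi> x))"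
      by (auto simp: f_def \<psi>_def fun_eq_iff indicator_def)
    then show "(LINT x|lborel. f x y) = - (G y * \<phi> y)"
      using integral_indicator_atLeast_deriv[OF \<phi>, of y] by simp
  qed simp
  also have "\<dots> = (LINT y|lebesgue. - (G y * \<phi> y))"
  proof (rule integral_completion[symmetric])
    have [measurable]: "\<phi> \<in> borel_measurable borel"
      using test_fun_continuous[OF \<phi>] by (rule borel_measurable_continuous_onI)
    show "(\<lambda>y. - (G y * \<phi> y)) \<in> borel_measurable lborel" by measurable
  qed
  also have "\<dots> = (LINT y|lebesgue. - (indicator {a<..<b} y * (g y * \<phi> y)))"
  proof (rule integral_cong_AE)
    have "\<phi> \<in> borel_measurable lebesgue"
      using borel_measurable_continuous_onI[OF test_fun_continuous[OF \<phi>]] by (simp add: measurable_completion)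
    then show "(\<lambda>y. - (G y * \<phi> y)) \<in> borel_measurable lebesgue"
      using borel_measurable_integrable[OF \<open>integrable lebesgue G\<close>] by (intro borel_measurable_uminus borel_measurable_times)
    show "AE y in lebesgue. - (G y * \<phi> y) = - (indicator {a<..<b} y * (g y * \<phi> y))"
      using ae by eventually_elim (simp add: G0_def[symmetric] flip: mult.assoc)
    show "(\<lambda>y. - (indicator {a<..<b} y * (g y * \<phi> y))) \<in> borel_measurable lebesgue"
      using loc_integrable_test_fun[OF L2_loc_integrable[OF g] \<phi>]
      by (auto simp: integrable_lebesgue_on_iff dest: borel_measurable_integrable)
  qed
  also have "\<dots> = - (LINT x|leb a b. g x * \<phi> x)" by (simp add: integral_lebesgue_on_eq)
  finally show ?thesis unfolding \<psi>_def .
qed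

lemma has_weak_deriv_const:
  assumes "a < b"
  shows "has_weak_deriv a b 1 (\<lambda>x. c) (\<lambda>x. 0)"
  unfolding has_weak_deriv_def
proof (intro conjI allI impI)
  show "loc_integrable a b (\<lambda>x. c)" "loc_integrable a b (\<lambda>x. 0)"
    by (intro L2_loc_integrable L2_continuous continuous_intros)+
  fix \<phi> assume \<phi>: "test_fun a b \<phi>"
  obtain c' d' where "a < c'" "d' < b" "\<And>x. x \<notin> {c'..d'} \<Longrightarrow> \<phi> x = 0"
    using test_fun_support[OF \<phi>] by blast
  then have "\<phi> a = 0" "\<phi> b = 0" by auto
  moreover have "(LINT x|leb a b. deriv \<phi> x) = \<phi> b - \<phi> a"
    by (intro integral_deriv_leb assms test_fun_DERIV[OF \<phi>] test_fun_continuous[OF test_fun_deriv[OF \<phi>]])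
  ultimately show "(LINT x|leb a b. c * (deriv ^^ 1) \<phi> x) = (- 1) ^ 1 * (LINT x|leb a b. 0 * \<phi> x)"
    by simp
qed

lemma has_weak_deriv_K:
  assumes "a < b" "g \<in> L2 a b"
  shows "has_weak_deriv a b 1 (\<lambda>x. c + K a g x) g"
proof -
  have "has_weak_deriv a b 1 (K a g) g"
    unfolding has_weak_deriv_def
    using integral_K_deriv[OF assms(2)] L2_loc_integrable[OF assms(2)] L2_loc_integrable[OF K_L2[OF assms(2)]]
    by simp
  from has_weak_deriv_diff[OF this has_weak_deriv_const[OF assms(1), of "- c"]] show ?thesis
    by (simp add: add.commute)
qed

lemma has_weak_deriv_poly:
  assumes "a < b"
  shows "has_weak_deriv a b n (poly p) (poly ((pderiv ^^ n) p))"
proof (induction n arbitrary: p)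
  case 0
  then show ?case by (simp add: has_weak_deriv_0)
next
  case (Suc n)
  have "has_weak_deriv a b 1 (poly p) (poly (pderiv p))"
    by (rule has_weak_deriv_ae_eq[OF has_weak_deriv_K[OF assms, of "poly (pderiv p)" "poly p a"]])
      (auto intro!: ae_eqI simp: K_poly)
  from has_weak_deriv_Suc[OF this Suc[of "pderiv p"]] show ?case
    by (simp only: funpow_Suc_right comp_def)
qed

section \<open>The spaces and the projectors\<close>

lemma poly_in_polys: "p = 0 \<or> degree p < n \<Longrightarrow> poly p \<in> polys a b (int n - 1)"
  unfolding polys_iff by (intro exI[of _ p]) simp

lemma ae_eq_const_imp_polys:
  assumes "ae_eq a b f (\<lambda>x. c)"
  shows "f \<in> polys a b 0"
proof -
  have "poly [:c:] = (\<lambda>x. c)" by auto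
  then have "f \<in> polys a b (int 1 - 1)"
    unfolding polys_iff using assms by (intro exI[of _ "[:c:]"]) simp
  then show ?thesis by simp
qed

lemma polys_0_imp_const:
  assumes "f \<in> polys a b 0"
  obtains c where "ae_eq a b f (\<lambda>x. c)"
proof -
  obtain p where p: "p = 0 \<or> degree p < 1" "ae_eq a b f (poly p)"
    using assms polys_iff[of f a b 1] by auto
  from p(1) have "degree p = 0" by auto
  then obtain c where "p = [:c:]" by (rule degree_eq_zeroE)
  then have "poly p = (\<lambda>x. c)" by auto
  with p(2) show ?thesis using that by simp
qed

text \<open>A discrepancy on a null set can be moved into the summand from
  \<open>polys a b 0\<close>, which is closed under equality almost everywhere. Membership in
  \<open>Zspace\<close> is handled through this form.\<close>

lemma set_sum_K_iff:
  assumes "V \<subseteq> L2 a b"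
  shows "v \<in> set_sum (polys a b 0) (K a ` V) \<longleftrightarrow> (\<exists>c. \<exists>w\<in>V. ae_eq a b v (\<lambda>x. c + K a w x))"
proof
  assume "v \<in> set_sum (polys a b 0) (K a ` V)"
  then obtain f w where v: "v = (\<lambda>x. f x + K a w x)" "f \<in> polys a b 0" "w \<in> V"
    unfolding set_sum_def by auto
  obtain c where "ae_eq a b f (\<lambda>x. c)" using v(2) by (rule polys_0_imp_const)
  from ae_eq_add[OF this ae_eq_refl[of a b "K a w"]] show "\<exists>c. \<exists>w\<in>V. ae_eq a b v (\<lambda>x. c + K a w x)"
    using v by (intro exI[of _ c] bexI[of _ w]) simp_all
next
  assume "\<exists>c. \<exists>w\<in>V. ae_eq a b v (\<lambda>x. c + K a w x)"
  then obtain c w where w: "w \<in> V" "ae_eq a b v (\<lambda>x. c + K a w x)" by auto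
  have "ae_eq a b (\<lambda>x. v x - K a w x) (\<lambda>x. c)"
    using ae_eq_diff[OF w(2) ae_eq_refl[of a b "K a w"]] by simp
  then have "(\<lambda>x. v x - K a w x) \<in> polys a b 0" by (rule ae_eq_const_imp_polys)
  then show "v \<in> set_sum (polys a b 0) (K a ` V)"
    using w(1) unfolding set_sum_def
    by (intro CollectI exI[of _ "\<lambda>x. v x - K a w x"] exI[of _ "K a w"]) simp
qed

lemma set_sum_K_L2:
  assumes "V \<subseteq> L2 a b"
  shows "set_sum (polys a b 0) (K a ` V) \<subseteq> L2 a b"
proof
  fix v assume "v \<in> set_sum (polys a b 0) (K a ` V)"
  then obtain c w where "w \<in> V" "ae_eq a b v (\<lambda>x. c + K a w x)"
    unfolding set_sum_K_iff[OF assms] by auto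
  moreover from this have "(\<lambda>x. c + K a w x) \<in> L2 a b"
    using assms by (intro L2_add[OF L2_continuous[OF continuous_on_const] K_L2]) auto
  ultimately show "v \<in> L2 a b" by (auto intro: L2_ae_eq[OF _ ae_eq_sym])
qed

lemma L2_subspace_set_sum_K:
  assumes "L2_subspace a b V"
  shows "L2_subspace a b (set_sum (polys a b 0) (K a ` V))"
proof -
  note V = L2_subspaceD[OF assms]
  note iff = set_sum_K_iff[OF V(1)]
  show ?thesis
    unfolding L2_subspace_def
  proof (intro conjI ballI allI impI)
    show "set_sum (polys a b 0) (K a ` V) \<subseteq> L2 a b" by (rule set_sum_K_L2[OF V(1)])
    show "(\<lambda>x. 0) \<in> set_sum (polys a b 0) (K a ` V)"
      unfolding iff by (intro exI[of _ 0] bexI[OF _ V(2)]) (simp add: K_def)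
  next
    fix f g assume "f \<in> set_sum (polys a b 0) (K a ` V)" "g \<in> set_sum (polys a b 0) (K a ` V)"
    then obtain c w c' w' where w: "w \<in> V" "ae_eq a b f (\<lambda>x. c + K a w x)"
      and w': "w' \<in> V" "ae_eq a b g (\<lambda>x. c' + K a w' x)"
      unfolding iff by auto
    have "w \<in> L2 a b" "w' \<in> L2 a b" using w(1) w'(1) V(1) by auto
    then have "ae_eq a b (\<lambda>x. (c + K a w x) + (c' + K a w' x)) (\<lambda>x. (c + c') + K a (\<lambda>x. w x + w' x) x)"
      by (intro ae_eqI) (simp add: K_add[of _ a b])
    from ae_eq_trans[OF ae_eq_add[OF w(2) w'(2)] this]
    show "(\<lambda>x. f x + g x) \<in> set_sum (polys a b 0) (K a ` V)"
      unfolding iff by (intro exI[of _ "c + c'"] bexI[OF _ V(3)[OF w(1) w'(1)]])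
  next
    fix k f assume "f \<in> set_sum (polys a b 0) (K a ` V)"
    then obtain c w where w: "w \<in> V" "ae_eq a b f (\<lambda>x. c + K a w x)"
      unfolding iff by auto
    have "(\<lambda>x. k * (c + K a w x)) = (\<lambda>x. k * c + K a (\<lambda>x. k * w x) x)"
      by (simp add: K_cmult distrib_left)
    with ae_eq_cmult[OF w(2), of k] show "(\<lambda>x. k * f x) \<in> set_sum (polys a b 0) (K a ` V)"
      unfolding iff by (intro exI[of _ "k * c"] bexI[OF _ V(4)[OF w(1)]]) simp
  next
    fix f g assume "f \<in> set_sum (polys a b 0) (K a ` V)" and fg: "ae_eq a b f g"
    then obtain c w where w: "w \<in> V" "ae_eq a b f (\<lambda>x. c + K a w x)"
      unfolding iff by auto
    from ae_eq_trans[OF ae_eq_sym[OF fg] w(2)] w(1) show "g \<in> set_sum (polys a b 0) (K a ` V)"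
      unfolding iff by auto
  qed
qed

lemma L2_finite_dim_set_sum_K:
  assumes "V \<subseteq> L2 a b" "L2_finite_dim a b V"
  shows "L2_finite_dim a b (set_sum (polys a b 0) (K a ` V))"
proof -
  obtain B where B: "finite B" "B \<subseteq> L2 a b"
    "\<And>f. f \<in> V \<Longrightarrow> \<exists>c. ae_eq a b f (\<lambda>x. \<Sum>g\<in>B. c g * g x)"
    using assms(2) unfolding L2_finite_dim_def by auto
  \<comment> \<open>The constant is indexed by \<open>None\<close>, so it keeps its own coefficient
    even if some \<open>K a g\<close> is the same function.\<close>
  define F where "F i = (case i of None \<Rightarrow> (\<lambda>x. 1) | Some g \<Rightarrow> K a g)" for i
  show ?thesis
  proof (rule L2_finite_dimI[of "insert None (Some ` B)" F])
    show "finite (insert None (Some ` B))" using B(1) by simp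
    have "(\<lambda>x. 1) \<in> L2 a b" by (intro L2_continuous continuous_intros)
    then show "F i \<in> L2 a b" if "i \<in> insert None (Some ` B)" for i
      using that B(2) by (auto simp: F_def intro!: K_L2)
    fix v assume "v \<in> set_sum (polys a b 0) (K a ` V)"
    then obtain c w where w: "w \<in> V" "ae_eq a b v (\<lambda>x. c + K a w x)"
      unfolding set_sum_K_iff[OF assms(1)] by auto
    obtain k where k: "ae_eq a b w (\<lambda>x. \<Sum>g\<in>B. k g * g x)" using B(3)[OF w(1)] by (rule exE)
    define k' where "k' i = (case i of None \<Rightarrow> c | Some g \<Rightarrow> k g)" for i
    have "ae_eq a b (\<lambda>x. c + K a w x) (\<lambda>x. \<Sum>i\<in>insert None (Some ` B). k' i * F i x)"
    proof (rule ae_eqI)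
      fix x assume "x < b"
      have "w \<in> L2 a b" using w(1) assms(1) by auto
      then have "K a w x = K a (\<lambda>x. \<Sum>g\<in>B. k g * g x) x"
        using k \<open>x < b\<close> by (intro K_ae_eq) auto
      also have "\<dots> = (\<Sum>g\<in>B. K a (\<lambda>x. k g * g x) x)"
        using B \<open>x < b\<close> by (intro K_sum[where b = b] L2_cmult) auto
      finally show "c + K a w x = (\<Sum>i\<in>insert None (Some ` B). k' i * F i x)"
        using B(1) by (simp add: sum.reindex K_cmult k'_def F_def)
    qed
    from ae_eq_trans[OF w(2) this] show "\<exists>c. ae_eq a b v (\<lambda>x. \<Sum>i\<in>insert None (Some ` B). c i * F i x)"
      by (rule exI[of _ k'])
  qed
qed

lemma Zspace_L2_subspace: "L2_subspace a b Z0 \<Longrightarrow> L2_subspace a b (Zspace a b Z0 t)"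
  by (induction t) (simp_all add: L2_subspace_set_sum_K)

lemma Zspace_L2_finite_dim:
  assumes "L2_subspace a b Z0" "L2_finite_dim a b Z0"
  shows "L2_finite_dim a b (Zspace a b Z0 t)"
  using assms by (induction t)
    (simp_all add: L2_finite_dim_set_sum_K L2_subspaceD(1)[OF Zspace_L2_subspace])

lemma Zspace_Suc_iff:
  assumes "L2_subspace a b Z0"
  shows "v \<in> Zspace a b Z0 (Suc t) \<longleftrightarrow> (\<exists>c. \<exists>w\<in>Zspace a b Z0 t. ae_eq a b v (\<lambda>x. c + K a w x))"
  unfolding Zspace.simps by (intro set_sum_K_iff L2_subspaceD(1)[OF Zspace_L2_subspace[OF assms]])

lemma poly_eq_K_pderiv: "ae_eq a b (poly p) (\<lambda>x. poly p a + K a (poly (pderiv p)) x)"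
  by (rule ae_eqI) (simp add: K_poly)

text \<open>Induction on t through p = p(a) + K p', with p' one degree lower. The bound n <= t + 1
  means degree at most t.\<close>

lemma polys_subset_Zspace:
  assumes Z0: "L2_subspace a b Z0" "polys a b 0 \<subseteq> Z0" and "n \<le> Suc t"
  shows "polys a b (int n - 1) \<subseteq> Zspace a b Z0 t"
proof -
  have "poly p \<in> Zspace a b Z0 t" if "p = 0 \<or> degree p < Suc t" for p
    using that
  proof (induction t arbitrary: p)
    case 0
    then have "poly p \<in> polys a b 0" using poly_in_polys[of p 1] by simp
    then show ?case using Z0(2) by auto
  next
    case (Suc t)
    then have "pderiv p = 0 \<or> degree (pderiv p) < Suc t" by (auto simp: degree_pderiv)
    then have "poly (pderiv p) \<in> Zspace a b Z0 t" by (rule Suc.IH)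
    then show ?case unfolding Zspace_Suc_iff[OF Z0(1)]
      by (intro exI[of _ "poly p a"] bexI[of _ "poly (pderiv p)"] poly_eq_K_pderiv)
  qed
  note poly_Z = this
  show ?thesis
  proof
    fix f assume "f \<in> polys a b (int n - 1)"
    then obtain p where p: "p = 0 \<or> degree p < n" "ae_eq a b f (poly p)" unfolding polys_iff by blast
    from p(1) assms(3) have "poly p \<in> Zspace a b Z0 t" by (intro poly_Z) auto
    then show "f \<in> Zspace a b Z0 t"
      by (rule L2_subspaceD(5)[OF Zspace_L2_subspace[OF Z0(1)] _ ae_eq_sym[OF p(2)]])
  qed
qed

text \<open>Each step writes v = c + K w with w one level lower, so q steps reach level t - q. The
  kernel of the q-th derivative is tracked in the same induction: if \<open>z\<close> is null, w is
  a polynomial of degree less than q - 1, and integrating it raises the degree by one.\<close>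

lemma Zspace_has_weak_deriv:
  assumes "a < b" "L2_subspace a b Z0" "q \<le> t" "v \<in> Zspace a b Z0 t"
  shows "\<exists>z\<in>Zspace a b Z0 (t - q). has_weak_deriv a b q v z \<and>
    (ae_eq a b z (\<lambda>x. 0) \<longrightarrow> v \<in> polys a b (int q - 1))"
  using assms(3,4)
proof (induction q arbitrary: t v)
  case 0
  have "v \<in> L2 a b" using 0(2) L2_subspaceD(1)[OF Zspace_L2_subspace[OF assms(2)]] by auto
  moreover have "v \<in> polys a b (int 0 - 1)" if "ae_eq a b v (\<lambda>x. 0)"
    unfolding polys_iff using that by (intro exI[of _ 0]) (simp add: poly_0[abs_def])
  ultimately show ?case using 0 by (intro bexI[of _ v]) (auto intro: has_weak_deriv_0)
next
  case (Suc q)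
  then obtain s where s: "t = Suc s" "q \<le> s" by (cases t) auto
  then obtain c w where w: "w \<in> Zspace a b Z0 s" "ae_eq a b v (\<lambda>x. c + K a w x)"
    using Suc.prems(2) unfolding s(1) Zspace_Suc_iff[OF assms(2)] by auto
  obtain z where z: "z \<in> Zspace a b Z0 (s - q)" "has_weak_deriv a b q w z"
    "ae_eq a b z (\<lambda>x. 0) \<Longrightarrow> w \<in> polys a b (int q - 1)"
    using Suc.IH[OF s(2) w(1)] by auto
  have L2: "v \<in> L2 a b" "w \<in> L2 a b"
    using w(1) Suc.prems(2) L2_subspaceD(1)[OF Zspace_L2_subspace[OF assms(2)]] by blast+
  have "has_weak_deriv a b 1 v w"
    by (rule has_weak_deriv_ae_eq[OF has_weak_deriv_K[OF assms(1) L2(2)] L2 w(2) ae_eq_refl])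
  then have "has_weak_deriv a b (Suc q) v z" using z(2) by (rule has_weak_deriv_Suc)
  moreover have "v \<in> polys a b (int (Suc q) - 1)" if "ae_eq a b z (\<lambda>x. 0)"
  proof -
    obtain p where p: "p = 0 \<or> degree p < q" "ae_eq a b w (poly p)"
      using z(3)[OF \<open>ae_eq a b z _\<close>] unfolding polys_iff by blast
    obtain P where P: "pderiv P = p" using pderiv_surj by blast
    then have "degree P < Suc q" using p(1) pderiv_eq_0_iff[of P] by (auto simp: degree_pderiv)
    \<comment> \<open>The antiderivative of \<open>p\<close> normalised to take the value
      \<open>c\<close> at \<open>a\<close>.\<close>
    define R where "R = P + [:c - poly P a:]"
    have "degree R < Suc q" unfolding R_def using \<open>degree P < Suc q\<close> by (intro degree_add_less) auto
    have "ae_eq a b (\<lambda>x. c + K a w x) (poly R)"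
      by (rule ae_eqI) (simp add: K_ae_eq[OF L2(2) p(2)] K_poly R_def flip: P)
    from ae_eq_trans[OF w(2) this] show ?thesis
      unfolding polys_iff using \<open>degree R < Suc q\<close> by auto
  qed
  ultimately show ?case using z(1) s by (intro bexI[of _ z]) auto
qed

section \<open>Sobolev functions and existence of the projections\<close>

lemma sobolev_L2: "u \<in> sobolev a b q \<Longrightarrow> u \<in> L2 a b"
  by (simp add: sobolev_def)

lemma sobolev_has_weak_deriv:
  assumes "u \<in> sobolev a b q" "n \<le> q"
  obtains g where "g \<in> L2 a b" "has_weak_deriv a b n u g"
proof (cases "n = 0")
  case True
  have "u \<in> L2 a b" using assms(1) by (rule sobolev_L2)
  then show ?thesis using that[of u] has_weak_deriv_0 True by auto
next
  case False
  then have "n \<in> {1..q}" using assms(2) by auto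
  then have "\<exists>g\<in>L2 a b. has_weak_deriv a b n u g" using assms(1) unfolding sobolev_def by blast
  then show ?thesis using that by auto
qed

lemma sobolev_weak_deriv:
  assumes "u \<in> sobolev a b (Suc q)"
  shows "has_weak_deriv a b 1 u (weak_deriv a b 1 u)" "weak_deriv a b 1 u \<in> sobolev a b q"
proof -
  obtain g where g: "g \<in> L2 a b" "has_weak_deriv a b 1 u g"
    using sobolev_has_weak_deriv[OF assms, of 1] by auto
  show *: "has_weak_deriv a b 1 u (weak_deriv a b 1 u)" by (rule weak_deriv_works[OF g(2)])
  have "weak_deriv a b 1 u \<in> L2 a b" by (rule L2_ae_eq[OF g(1) weak_deriv_ae_eq[OF g(2)]])
  moreover have "\<exists>h\<in>L2 a b. has_weak_deriv a b n (weak_deriv a b 1 u) h" if "n \<in> {1..q}" for n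
  proof -
    from that have "Suc n \<le> Suc q" by simp
    then obtain h where "h \<in> L2 a b" "has_weak_deriv a b (Suc n) u h"
      using sobolev_has_weak_deriv[OF assms] by blast
    then show ?thesis using has_weak_deriv_Suc_imp[OF *] by blast
  qed
  ultimately show "weak_deriv a b 1 u \<in> sobolev a b q" by (simp add: sobolev_def)
qed

lemma orth_proj_works:
  assumes "L2_subspace a b V" "L2_finite_dim a b V" "u \<in> L2 a b"
  shows "orth_proj a b V u \<in> V" "w \<in> V \<Longrightarrow> ip a b (\<lambda>x. u x - orth_proj a b V u x) w = 0"
proof -
  obtain v where "v \<in> V" "\<And>w. w \<in> V \<Longrightarrow> ip a b (\<lambda>x. u x - v x) w = 0"
    using L2_projection_exists[OF assms] by auto
  then have "\<exists>v. v \<in> V \<and> (\<forall>w\<in>V. ip a b (\<lambda>x. u x - v x) w = 0)" by (intro exI[of _ v]) simp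
  from someI_ex[OF this] show "orth_proj a b V u \<in> V" "w \<in> V \<Longrightarrow> ip a b (\<lambda>x. u x - orth_proj a b V u x) w = 0"
    unfolding orth_proj_def by auto
qed

text \<open>The point value in the recursion only contributes a constant, so which constant it is does not matter.\<close>

lemma Qproj_weak_deriv:
  assumes "a < b" and Z0: "L2_subspace a b Z0" "L2_finite_dim a b Z0"
    and "q \<le> t" "u \<in> sobolev a b q"
  shows "Qproj a b Z0 q t u \<in> Zspace a b Z0 t \<and>
    (\<exists>z\<in>Zspace a b Z0 (t - q). has_weak_deriv a b q (Qproj a b Z0 q t u) z \<and>
      (\<forall>g\<in>L2 a b. has_weak_deriv a b q u g \<longrightarrow>
        (\<forall>w\<in>Zspace a b Z0 (t - q). ip a b (\<lambda>x. g x - z x) w = 0)))"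
  using assms(4,5)
proof (induction q arbitrary: t u)
  case 0
  let ?Z = "Zspace a b Z0 t"
  have Z: "L2_subspace a b ?Z" "L2_finite_dim a b ?Z"
    by (intro Zspace_L2_subspace Zspace_L2_finite_dim Z0)+
  have u: "u \<in> L2 a b" using 0(2) by (rule sobolev_L2)
  define z where "z = orth_proj a b ?Z u"
  have z: "z \<in> ?Z" "\<And>w. w \<in> ?Z \<Longrightarrow> ip a b (\<lambda>x. u x - z x) w = 0"
    unfolding z_def by (rule orth_proj_works[OF Z u], assumption?)+
  have zL: "z \<in> L2 a b" using z(1) L2_subspaceD(1)[OF Z(1)] by auto
  have "ip a b (\<lambda>x. g x - z x) w = 0" if g: "g \<in> L2 a b" "has_weak_deriv a b 0 u g" and w: "w \<in> ?Z" for g w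
  proof -
    have "ae_eq a b u g" by (rule has_weak_deriv_unique[OF has_weak_deriv_0[OF u] g(2)])
    from ae_eq_diff[OF this ae_eq_refl]
    have "ip a b (\<lambda>x. u x - z x) w = ip a b (\<lambda>x. g x - z x) w"
      using w L2_subspaceD(1)[OF Z(1)] by (intro ip_ae_eq L2_diff u zL) auto
    then show ?thesis using z(2)[OF w] by simp
  qed
  then show ?case using z(1) has_weak_deriv_0[OF zL] by (auto simp flip: z_def)
next
  case (Suc q)
  then obtain s where s: "t = Suc s" "q \<le> s" by (cases t) auto
  define u' where "u' = weak_deriv a b 1 u"
  have u': "has_weak_deriv a b 1 u u'" "u' \<in> sobolev a b q"
    unfolding u'_def by (rule sobolev_weak_deriv[OF Suc.prems(2)])+
  define Q' where "Q' = Qproj a b Z0 q s u'"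
  obtain z where Q': "Q' \<in> Zspace a b Z0 s" and z: "z \<in> Zspace a b Z0 (s - q)"
    "has_weak_deriv a b q Q' z"
    "\<And>g w. g \<in> L2 a b \<Longrightarrow> has_weak_deriv a b q u' g \<Longrightarrow> w \<in> Zspace a b Z0 (s - q) \<Longrightarrow> ip a b (\<lambda>x. g x - z x) w = 0"
    using Suc.IH[OF s(2) u'(2)] unfolding Q'_def by auto
  have Q: "Qproj a b Z0 (Suc q) t u = (\<lambda>x. point_value a b u a + K a Q' x)"
    by (simp add: s Q'_def u'_def)
  have "Q' \<in> L2 a b" using Q' L2_subspaceD(1)[OF Zspace_L2_subspace[OF Z0(1)]] by auto
  have "Qproj a b Z0 (Suc q) t u \<in> Zspace a b Z0 t"
    unfolding Q unfolding s(1) Zspace_Suc_iff[OF Z0(1)]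
    by (intro exI[of _ "point_value a b u a"] bexI[OF _ Q'] ae_eq_refl)
  moreover have "has_weak_deriv a b (Suc q) (Qproj a b Z0 (Suc q) t u) z"
    unfolding Q by (rule has_weak_deriv_Suc[OF has_weak_deriv_K[OF assms(1) \<open>Q' \<in> L2 a b\<close>] z(2)])
  \<comment> \<open>A weak derivative of u of order q + 1 is one of u' of order q, so the
    orthogonality from the induction hypothesis carries over with the same \<open>z\<close>.\<close>
  moreover have "ip a b (\<lambda>x. g x - z x) w = 0"
    if "g \<in> L2 a b" "has_weak_deriv a b (Suc q) u g" "w \<in> Zspace a b Z0 (s - q)" for g w
    using that z(3) has_weak_deriv_Suc_imp[OF u'(1)] by blast
  ultimately show ?case using z(1) s by auto
qed

lemma pderiv_funpow_eq_0:
  fixes p :: "real poly"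
  assumes "p = 0 \<or> degree p < n"
  shows "(pderiv ^^ n) p = 0"
  using assms
proof (induction n arbitrary: p)
  case (Suc n)
  then have "pderiv p = 0 \<or> degree (pderiv p) < n" by (auto simp: degree_pderiv pderiv_eq_0_iff)
  then have "(pderiv ^^ n) (pderiv p) = 0" by (rule Suc.IH)
  then show ?case by (simp only: funpow_Suc_right comp_def)
qed simp

text \<open>The witness behind the \<open>SOME\<close> is Q u plus the projection of u - Q u onto
  polynomials of degree less than q. The added polynomial is killed by the q-th derivative, which is
  therefore still the projection of that of u, and it makes the moments match.\<close>

lemma ritz_characterization:
  assumes "a < b" and Z0: "L2_subspace a b Z0" "L2_finite_dim a b Z0" "polys a b 0 \<subseteq> Z0"
    and "q \<le> t" "u \<in> sobolev a b q"
  shows "ritz a b Z0 q t u \<in> Zspace a b Z0 t \<and>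
     (\<forall>v\<in>Zspace a b Z0 t.
        ip a b (weak_deriv a b q (ritz a b Z0 q t u)) (weak_deriv a b q v) =
        ip a b (weak_deriv a b q u) (weak_deriv a b q v)) \<and>
     (\<forall>g\<in>polys a b (int q - 1). ip a b (ritz a b Z0 q t u) g = ip a b u g)"
proof -
  let ?Z = "Zspace a b Z0"
  note Zsub = L2_subspaceD[OF Zspace_L2_subspace[OF Z0(1)]]
  define Q where "Q = Qproj a b Z0 q t u"
  obtain z where Q: "Q \<in> ?Z t" and z: "z \<in> ?Z (t - q)" "has_weak_deriv a b q Q z"
    "\<And>g w. g \<in> L2 a b \<Longrightarrow> has_weak_deriv a b q u g \<Longrightarrow> w \<in> ?Z (t - q) \<Longrightarrow> ip a b (\<lambda>x. g x - z x) w = 0"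
    using Qproj_weak_deriv[OF assms(1) Z0(1,2) assms(5,6)] unfolding Q_def by auto
  have L2: "u \<in> L2 a b" "Q \<in> L2 a b" "z \<in> L2 a b"
    using sobolev_L2[OF assms(6)] Q z(1) Zsub(1) by auto
  obtain g where g: "g \<in> polys a b (int q - 1)"
    "\<And>h. h \<in> polys a b (int q - 1) \<Longrightarrow> ip a b (\<lambda>x. (u x - Q x) - g x) h = 0"
    using L2_projection_exists[OF L2_subspace_polys L2_finite_dim_polys L2_diff[OF L2(1,2)]] by metis
  obtain p where p: "p = 0 \<or> degree p < q" "ae_eq a b g (poly p)" using g(1) unfolding polys_iff by blast
  have gL: "g \<in> L2 a b" using g(1) by (simp add: polys_def)
  define r where "r = (\<lambda>x. Q x + g x)"
  have rZ: "r \<in> ?Z t" unfolding r_def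
    using g(1) polys_subset_Zspace[OF Z0(1,3), of q t] assms(5) by (intro Zsub(3) Q) auto
  \<comment> \<open>The sum of \<open>Q\<close> and \<open>p\<close> is read as a difference so that
    \<open>has_weak_deriv_diff\<close> applies.\<close>
  have "has_weak_deriv a b q (poly (- p)) (\<lambda>x. 0)"
    using has_weak_deriv_poly[OF assms(1), of q "- p"] p(1) pderiv_funpow_eq_0[of "- p" q]
    by (auto simp: poly_0[abs_def])
  from has_weak_deriv_diff[OF z(2) this]
  have "has_weak_deriv a b q r z"
  proof (rule has_weak_deriv_ae_eq)
    show "ae_eq a b r (\<lambda>x. Q x - poly (- p) x)"
      using ae_eq_add[OF ae_eq_refl[of a b Q] p(2)] by (simp add: r_def poly_minus)
  qed (use rZ Zsub(1) L2 in auto)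
  then have wr: "ae_eq a b z (weak_deriv a b q r)" by (rule weak_deriv_ae_eq)
  obtain gu where gu: "gu \<in> L2 a b" "has_weak_deriv a b q u gu"
    using sobolev_has_weak_deriv[OF assms(6), of q] by auto
  have wu: "ae_eq a b gu (weak_deriv a b q u)" using gu(2) by (rule weak_deriv_ae_eq)
  have "ip a b (weak_deriv a b q r) (weak_deriv a b q v) = ip a b (weak_deriv a b q u) (weak_deriv a b q v)"
    if v: "v \<in> ?Z t" for v
  proof -
    obtain zv where zv: "zv \<in> ?Z (t - q)" "has_weak_deriv a b q v zv"
      using Zspace_has_weak_deriv[OF assms(1) Z0(1) assms(5) v] by auto
    have zvL: "zv \<in> L2 a b" using zv(1) Zsub(1) by auto
    have wv: "ae_eq a b zv (weak_deriv a b q v)" using zv(2) by (rule weak_deriv_ae_eq)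
    have "ip a b gu zv - ip a b z zv = 0"
      using z(3)[OF gu zv(1)] by (simp add: ip_diff_left gu(1) L2(3) zvL)
    then show ?thesis
      using ip_ae_eq[OF L2(3) zvL wr wv] ip_ae_eq[OF gu(1) zvL wu wv] by simp
  qed
  moreover have "ip a b r h = ip a b u h" if h: "h \<in> polys a b (int q - 1)" for h
  proof -
    have "h \<in> L2 a b" using h by (simp add: polys_def)
    then show ?thesis using g(2)[OF h] L2 gL
      by (simp add: r_def ip_diff_left ip_add_left L2_diff)
  qed
  ultimately have "\<exists>r. r \<in> ?Z t \<and>
     (\<forall>v\<in>?Z t. ip a b (weak_deriv a b q r) (weak_deriv a b q v) = ip a b (weak_deriv a b q u) (weak_deriv a b q v)) \<and>
     (\<forall>g\<in>polys a b (int q - 1). ip a b r g = ip a b u g)"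
    using rZ by (intro exI[of _ r]) simp
  from someI_ex[OF this] show ?thesis unfolding ritz_def .
qed

section \<open>Iterated derivative bounds and the final estimate\<close>

lemma d_coeff_eq: "d_coeff n = sqrt (markov_const n)"
  by (simp add: d_coeff_def markov_const_def)

lemma d_coeff_nonneg: "0 \<le> d_coeff n"
  by (simp add: d_coeff_eq markov_const_nonneg)

lemma nrm_pderiv_le:
  assumes "a < b" "degree p \<le> n"
  shows "nrm a b (poly (pderiv p)) \<le> 1 / (b - a) * d_coeff n * nrm a b (poly p)"
proof -
  have "sqrt ((b - a)\<^sup>2 * pint a b (pderiv p * pderiv p)) \<le> sqrt (markov_const n * pint a b (p * p))"
    using markov_L2[OF assms] by (rule real_sqrt_le_mono)
  then have "(b - a) * nrm a b (poly (pderiv p)) \<le> d_coeff n * nrm a b (poly p)"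
    using assms(1) by (simp add: nrm_def ip_poly d_coeff_eq real_sqrt_mult)
  then show ?thesis using assms(1) by (simp add: field_simps)
qed

lemma degree_funpow_pderiv: "degree ((pderiv ^^ n) p) = degree (p :: real poly) - n"
  by (induction n) (simp_all add: degree_pderiv)

text \<open>After l differentiations the degree is at most q - 1 - l, so the next one contributes
  \<open>d_coeff (q - 1 - l)\<close>; the indices run downwards from q - 1.\<close>

lemma nrm_funpow_pderiv_le:
  assumes "a < b" "degree p < q" "l < q"
  shows "nrm a b (poly ((pderiv ^^ l) p)) \<le> (1 / (b - a)) ^ l * (\<Prod>i=q-l..q-1. d_coeff i) * nrm a b (poly p)"
  using assms(3)
proof (induction l)
  case 0
  \<comment> \<open>This relies on q > 0: with truncated subtraction the interval for q = 0 would be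
    {0}.\<close>
  then have "{q..q - 1} = {}" by auto
  then show ?case by simp
next
  case (Suc l)
  let ?P = "\<lambda>l. \<Prod>i=q-l..q-1. d_coeff i"
  have "{q - Suc l..q - 1} = insert (q - Suc l) {q - l..q - 1}" using Suc.prems by auto
  then have P: "?P (Suc l) = d_coeff (q - Suc l) * ?P l" using Suc.prems by simp
  have "degree ((pderiv ^^ l) p) \<le> q - Suc l"
    using assms(2) by (simp add: degree_funpow_pderiv)
  from nrm_pderiv_le[OF assms(1) this]
  have "nrm a b (poly ((pderiv ^^ Suc l) p)) \<le> 1 / (b - a) * d_coeff (q - Suc l) * nrm a b (poly ((pderiv ^^ l) p))"
    by simp
  also have "\<dots> \<le> 1 / (b - a) * d_coeff (q - Suc l) * ((1 / (b - a)) ^ l * ?P l * nrm a b (poly p))"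
    using assms(1) Suc by (intro mult_left_mono mult_nonneg_nonneg) (auto simp: d_coeff_nonneg)
  also have "\<dots> = (1 / (b - a)) ^ Suc l * ?P (Suc l) * nrm a b (poly p)" unfolding P by simp
  finally show ?case .
qed

text \<open>Membership of \<open>e\<close> in \<open>sobolev a b l\<close> is part of each claim,
  because \<open>weak_deriv\<close> is an arbitrary function when no weak derivative exists.\<close>

theorem proposition4:
  fixes a b :: real and Z0 :: "(real \<Rightarrow> real) set" and q t :: nat and u :: "real \<Rightarrow> real"
  assumes "a < b"
    and "L2_subspace a b Z0" and "L2_finite_dim a b Z0" and "polys a b 0 \<subseteq> Z0"
    and "\<And>s. s \<ge> 1 \<Longrightarrow>
           set_sum (polys a b 0) (K a ` Zspace a b Z0 (s - 1)) =
           set_sum (polys a b 0) (K_adj b ` Zspace a b Z0 (s - 1))"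
    and "q \<le> t"
    and "u \<in> sobolev a b q"
  defines "e \<equiv> (\<lambda>x. ritz a b Z0 q t u x - Qproj a b Z0 q t u x)"
  shows "nrm a b e \<le> nrm a b (\<lambda>x. u x - Qproj a b Z0 q t u x) \<and>
         (\<forall>l\<in>{1..<q}. e \<in> sobolev a b l \<and>
            nrm a b (weak_deriv a b l e) \<le> (1 / (b - a)) ^ l * (\<Prod>i=q-l..q-1. d_coeff i) * nrm a b e) \<and>
         (\<forall>l\<ge>q. e \<in> sobolev a b l \<and> nrm a b (weak_deriv a b l e) = 0)"
proof -
  let ?Z = "Zspace a b Z0"
  note Zsub = L2_subspaceD[OF Zspace_L2_subspace[OF assms(2)]]
  define Q where "Q = Qproj a b Z0 q t u"
  define r where "r = ritz a b Z0 q t u"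
  have e: "e = (\<lambda>x. r x - Q x)" by (simp add: e_def r_def Q_def)
  obtain zQ where Q: "Q \<in> ?Z t" and zQ: "zQ \<in> ?Z (t - q)" "has_weak_deriv a b q Q zQ"
    "\<And>g w. g \<in> L2 a b \<Longrightarrow> has_weak_deriv a b q u g \<Longrightarrow> w \<in> ?Z (t - q) \<Longrightarrow> ip a b (\<lambda>x. g x - zQ x) w = 0"
    using Qproj_weak_deriv[OF assms(1-3,6,7)] unfolding Q_def by auto
  have r: "r \<in> ?Z t"
    "\<And>v. v \<in> ?Z t \<Longrightarrow> ip a b (weak_deriv a b q r) (weak_deriv a b q v) = ip a b (weak_deriv a b q u) (weak_deriv a b q v)"
    "\<And>g. g \<in> polys a b (int q - 1) \<Longrightarrow> ip a b r g = ip a b u g"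
    using ritz_characterization[OF assms(1-4,6,7)] unfolding r_def by auto
  obtain zr where zr: "zr \<in> ?Z (t - q)" "has_weak_deriv a b q r zr"
    using Zspace_has_weak_deriv[OF assms(1,2,6) r(1)] by auto
  have eZ: "e \<in> ?Z t" unfolding e by (intro L2_subspace_diff[OF Zspace_L2_subspace[OF assms(2)]] r Q)
  obtain ze where ze: "ze \<in> ?Z (t - q)" "has_weak_deriv a b q e ze"
    "ae_eq a b ze (\<lambda>x. 0) \<Longrightarrow> e \<in> polys a b (int q - 1)"
    using Zspace_has_weak_deriv[OF assms(1,2,6) eZ] by auto
  obtain gu where gu: "gu \<in> L2 a b" "has_weak_deriv a b q u gu"
    using sobolev_has_weak_deriv[OF assms(7), of q] by auto
  have L2: "u \<in> L2 a b" "Q \<in> L2 a b" "r \<in> L2 a b" "e \<in> L2 a b" "zQ \<in> L2 a b" "zr \<in> L2 a b" "ze \<in> L2 a b"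
    using sobolev_L2[OF assms(7)] Q r(1) eZ zQ(1) zr(1) ze(1) Zsub(1) by auto
  have "has_weak_deriv a b q e (\<lambda>x. zr x - zQ x)"
    unfolding e by (rule has_weak_deriv_diff[OF zr(2) zQ(2)])
  then have ze_eq: "ae_eq a b ze (\<lambda>x. zr x - zQ x)" by (rule has_weak_deriv_unique[OF ze(2)])
  \<comment> \<open>The Ritz condition is tested with e itself. As \<open>ze\<close> lies in
    Z_(t-q), it can also be used against \<open>zQ\<close>; subtracting shows that \<open>ze\<close>
    is orthogonal to itself.\<close>
  have "ip a b zr ze = ip a b gu ze"
    using r(2)[OF eZ] ip_ae_eq[OF L2(6,7) weak_deriv_ae_eq[OF zr(2)] weak_deriv_ae_eq[OF ze(2)]]
      ip_ae_eq[OF gu(1) L2(7) weak_deriv_ae_eq[OF gu(2)] weak_deriv_ae_eq[OF ze(2)]] by simp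
  moreover have "ip a b gu ze - ip a b zQ ze = 0"
    using zQ(3)[OF gu ze(1)] by (simp add: ip_diff_left gu(1) L2)
  ultimately have "ip a b (\<lambda>x. zr x - zQ x) ze = 0" by (simp add: ip_diff_left L2)
  then have "ip a b ze ze = 0"
    using ip_ae_eq[OF L2(7,7) ze_eq ae_eq_refl] by simp
  then have e_polys: "e \<in> polys a b (int q - 1)" using ip_self_eq_0[OF L2(7)] ze(3) by simp
  then obtain p where p: "p = 0 \<or> degree p < q" "ae_eq a b e (poly p)" unfolding polys_iff by blast

  \<comment> \<open>As e is now known to be a polynomial of degree less than q, it is admissible in
    the moment condition for \<open>r\<close>.\<close>
  have "ip a b e e = ip a b (\<lambda>x. u x - Q x) e"
  proof -
    have "ip a b (\<lambda>x. r x - Q x) e = ip a b (\<lambda>x. u x - Q x) e"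
      using r(3)[OF e_polys] by (simp add: ip_diff_left L2)
    then show ?thesis using e by simp
  qed
  then have orth: "ip a b (\<lambda>x. (u x - Q x) - e x) e = 0" by (simp add: ip_diff_left L2 L2_diff)
  \<comment> \<open>Pythagoras for u - Q = f + e with f orthogonal to e.\<close>
  define f where "f = (\<lambda>x. (u x - Q x) - e x)"
  have fL: "f \<in> L2 a b" unfolding f_def by (intro L2_diff L2)
  define g where "g = (\<lambda>x. u x - Q x)"
  have g: "g = (\<lambda>x. f x + e x)" by (simp add: f_def g_def)
  have gL: "g \<in> L2 a b" unfolding g by (intro L2_add fL L2)
  have split: "ip a b g h = ip a b f h + ip a b e h" if "h \<in> L2 a b" for h
    unfolding g by (rule ip_add_left[OF fL L2(4) that])
  have "ip a b f e = 0" using orth by (simp add: f_def)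
  moreover have "ip a b f g = ip a b g f" "ip a b e g = ip a b g e" "ip a b e f = ip a b f e"
    by (rule ip_commute)+
  ultimately have "ip a b (\<lambda>x. u x - Q x) (\<lambda>x. u x - Q x) = ip a b f f + ip a b e e"
    using split[OF gL] split[OF fL] split[OF L2(4)] by (simp flip: g_def)
  then have "nrm a b e \<le> nrm a b (\<lambda>x. u x - Q x)"
    unfolding nrm_def using ip_self_nonneg[of a b f] by simp
  moreover have wd: "has_weak_deriv a b n e (poly ((pderiv ^^ n) p))" for n
    by (rule has_weak_deriv_ae_eq[OF has_weak_deriv_poly[OF assms(1)] L2(4) poly_L2 p(2) ae_eq_refl])
  moreover have "e \<in> sobolev a b l" for l
    unfolding sobolev_def using wd L2(4) poly_L2 by blast
  moreover have nrm_wd: "nrm a b (weak_deriv a b l e) = nrm a b (poly ((pderiv ^^ l) p))" for l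
    using nrm_ae_eq[OF poly_L2 weak_deriv_ae_eq[OF wd[of l]]] by simp
  moreover have nrm_e: "nrm a b e = nrm a b (poly p)" by (rule nrm_ae_eq[OF L2(4) p(2)])
  moreover have "nrm a b (weak_deriv a b l e) \<le> (1 / (b - a)) ^ l * (\<Prod>i=q-l..q-1. d_coeff i) * nrm a b e"
    if "l \<in> {1..<q}" for l
    unfolding nrm_wd nrm_e using that p(1) by (intro nrm_funpow_pderiv_le assms(1)) auto
  moreover have "nrm a b (weak_deriv a b l e) = 0" if "q \<le> l" for l
  proof -
    have "(pderiv ^^ l) p = 0" using p(1) that by (intro pderiv_funpow_eq_0) auto
    then show ?thesis unfolding nrm_wd by (simp add: nrm_def ip_poly)
  qed
  ultimately show ?thesis by (simp flip: Q_def)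
qed

end
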